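(* The mapping $K\mapsto T(K)$ gives a one-to-one correspondence between the set of positive definite multi-Toeplitz kernels $K$ on $\mathbb{F}_N^+$ with $K(\emptyset,\emptyset)=1$ and the set $\mathcal{S}_0(\mathcal{H})$.
   Context: Fix an integer $N\ge 1$ and $\mathcal{H}=\mathbb{C}^N$. $\mathbb{F}_N^+$ is the unital free semigroup on generators $1,\dots,N$; its elements are words, $\emptyset$ is the empty word (identity), and $|\sigma|$ is the length of $\sigma$. $\mathcal{H}_k$ ($k\ge 0$) is the Hilbert space $\mathbb{C}^{N^k}$ with orthonormal basis $\{e_\sigma\}_{|\sigma|=k}$ listed in lexicographic order; for $k\ge1$, $\mathcal{H}_k$ is identified with the direct sum of $N$ copies of $\mathcal{H}_{k-1}$, the $j$-th copy being spanned by the $e_{j\sigma}$, $|\sigma|=k-1$ ($e_{j\sigma}$ corresponding to $e_\sigma$ in the $j$-th copy). $R^{\oplus N}$ denotes the direct sum of $N$ copies of an operator $R$. $\mathcal{S}(\mathcal{H})$ is the set of contractions $T=[T_{ij}]_{i,j=0}^\infty$ in $\mathcal{L}(\bigoplus_{k=0}^\infty\mathcal{H}_k)$ (with $T_{ij}\in\mathcal{L}(\mathcal{H}_j,\mathcal{H}_i)$) that are upper triangular ($T_{ij}=0$ for $i>j$) and satisfy $T_{ij}=T_{i-1,j-1}^{\oplus N}$ for $1\le i\le j$. $\mathcal{S}_0(\mathcal{H})$ is the set of $T\in\mathcal{S}(\mathcal{H})$ with $T_{00}=0$. $K:\mathbb{F}_N^+\times\mathbb{F}_N^+\to\mathbb{C}$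 is a positive definite kernel if $\sum_{i,j=1}^m K(\sigma_i,\sigma_j)\lambda_j\overline{\lambda_i}\ge 0$ for all $m\geq1$, words $\sigma_i$ and complex numbers $\lambda_i$. It is multi-Toeplitz if it is invariant, i.e. $K(\tau\sigma,\tau\sigma')=K(\sigma,\sigma')$ for all words $\tau,\sigma,\sigma'$, and $K(\sigma,\tau)=0$ whenever there is no word $\alpha$ with $\sigma=\tau\alpha$ or $\tau=\sigma\alpha$. Definition of $T(K)$. For such $K$ with $K(\emptyset,\emptyset)=1$ put $S_{ij}=[K(\sigma,\tau)]_{|\sigma|=i,|\tau|=j}\in\mathcal{L}(\mathcal{H}_j,\mathcal{H}_i)$. For a row $x=(x_0,\dots,x_n)$ with $x_j\in\mathcal{L}(\mathcal{H}_j,\mathbb{C})$, let $U(x)=[U_{ij}]_{i,j=0}^n$ be the upper triangular operator on $\bigoplus_{l=0}^n\mathcal{H}_l$ with $U_{0j}=x_j$, $U_{ij}=U_{i-1,j-1}^{\oplus N}$ for $1\le i\le j\le n$, and $U_{ij}=0$ for $i>j$. Let $x_n=(1,S_{01},\dots,S_{0n})$ and $y_n=(0,S_{01},\dots,S_{0n})$. For each $n$ there is a unique $z_n$ such that $U(y_n)=U(z_n)U(x_n)$; moreover $U(z_n)$ is a contraction and $P_{\bigoplus_{l=0}^n\mathcal{H}_l}U(z_{n+1})|_{\bigoplus_{l=0}^n\mathcal{H}_l}=U(z_n)$. $T(K)$ is the unique element of $\mathcal{S}(\mathcal{H})$ with $P_{\bigoplus_{l=0}^n\mathcal{H}_l}T(K)|_{\bigoplus_{l=0}^n\mathcal{H}_l}=U(z_n)$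 for all $n\geq 1$; it satisfies $T(K)_{00}=0$. *)

theory Defs
  imports "HOL-Analysis.Analysis" "HOL-Library.Complex_Order"
begin

typedef 'a ell2 = "{f :: 'a \<Rightarrow> complex. (\<lambda>x. (cmod (f x))\<^sup>2) summable_on UNIV}"
  morphisms coord Abs_ell2
  by (rule exI[of _ "\<lambda>_. 0"]) simp

setup_lifting type_definition_ell2

lemma ell2_L2_set_le:
  assumes "(\<lambda>x. (cmod (f x))\<^sup>2) summable_on UNIV" "finite F"
  shows "L2_set (\<lambda>x. cmod (f x)) F \<le> sqrt (\<Sum>\<^sub>\<infinity>x. (cmod (f x))\<^sup>2)"
  unfolding L2_set_def
  by (intro real_sqrt_le_mono finite_sum_le_infsum) (use assms in auto)

lemma ell2_bounded:
  assumes "\<And>F. finite F \<Longrightarrow> L2_set (\<lambda>x. cmod (f x)) F \<le> C"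
  shows "(\<lambda>x. (cmod (f x))\<^sup>2) summable_on UNIV"
    and "sqrt (\<Sum>\<^sub>\<infinity>x. (cmod (f x))\<^sup>2) \<le> C"
proof -
  have C: "0 \<le> C" using assms[of "{}"] by simp
  have le: "(\<Sum>x\<in>F. (cmod (f x))\<^sup>2) \<le> C\<^sup>2" if "finite F" for F
    using assms[OF that] unfolding L2_set_def by (rule sqrt_le_D)
  show s: "(\<lambda>x. (cmod (f x))\<^sup>2) summable_on UNIV"
  proof (rule nonneg_bdd_above_summable_on)
    show "bdd_above (sum (\<lambda>x. (cmod (f x))\<^sup>2) ` {F. F \<subseteq> UNIV \<and> finite F})"
      by (rule bdd_aboveI2[where M = "C\<^sup>2"]) (use le in blast)
  qed simp
  have "(\<Sum>\<^sub>\<infinity>x. (cmod (f x))\<^sup>2) \<le> C\<^sup>2"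
    by (rule infsum_le_finite_sums[OF s le])
  then show "sqrt (\<Sum>\<^sub>\<infinity>x. (cmod (f x))\<^sup>2) \<le> C"
    using C by (intro real_le_lsqrt)
qed

lemma ell2_add:
  assumes "(\<lambda>x. (cmod (f x))\<^sup>2) summable_on UNIV" "(\<lambda>x. (cmod (g x))\<^sup>2) summable_on UNIV"
  shows "(\<lambda>x. (cmod (f x + g x))\<^sup>2) summable_on UNIV"
    and "sqrt (\<Sum>\<^sub>\<infinity>x. (cmod (f x + g x))\<^sup>2)
           \<le> sqrt (\<Sum>\<^sub>\<infinity>x. (cmod (f x))\<^sup>2) + sqrt (\<Sum>\<^sub>\<infinity>x. (cmod (g x))\<^sup>2)"
proof -
  have *: "L2_set (\<lambda>x. cmod (f x + g x)) F
             \<le> sqrt (\<Sum>\<^sub>\<infinity>x. (cmod (f x))\<^sup>2) + sqrt (\<Sum>\<^sub>\<infinity>x. (cmod (g x))\<^sup>2)"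
    if F: "finite F" for F
  proof -
    have "L2_set (\<lambda>x. cmod (f x + g x)) F \<le> L2_set (\<lambda>x. cmod (f x) + cmod (g x)) F"
      by (intro L2_set_mono norm_triangle_ineq norm_ge_zero)
    also have "\<dots> \<le> L2_set (\<lambda>x. cmod (f x)) F + L2_set (\<lambda>x. cmod (g x)) F"
      by (rule L2_set_triangle_ineq)
    also have "\<dots> \<le> sqrt (\<Sum>\<^sub>\<infinity>x. (cmod (f x))\<^sup>2) + sqrt (\<Sum>\<^sub>\<infinity>x. (cmod (g x))\<^sup>2)"
      by (intro add_mono ell2_L2_set_le assms F)
    finally show ?thesis .
  qed
  show "(\<lambda>x. (cmod (f x + g x))\<^sup>2) summable_on UNIV"
    and "sqrt (\<Sum>\<^sub>\<infinity>x. (cmod (f x + g x))\<^sup>2)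
           \<le> sqrt (\<Sum>\<^sub>\<infinity>x. (cmod (f x))\<^sup>2) + sqrt (\<Sum>\<^sub>\<infinity>x. (cmod (g x))\<^sup>2)"
    using ell2_bounded[of "\<lambda>x. f x + g x", OF *] by auto
qed

lemma ell2_scale:
  assumes "(\<lambda>x. (cmod (f x))\<^sup>2) summable_on UNIV"
  shows "(\<lambda>x. (cmod (c * f x))\<^sup>2) summable_on UNIV"
  using summable_on_cmult_right[OF assms, of "(cmod c)\<^sup>2"]
  by (simp add: norm_mult power_mult_distrib)

lift_definition cscale :: "complex \<Rightarrow> 'a ell2 \<Rightarrow> 'a ell2"
  is "\<lambda>c f x. c * f x"
  by (rule ell2_scale)

instantiation ell2 :: (type) real_normed_vector
begin

lift_definition zero_ell2 :: "'a ell2" is "\<lambda>_. 0" by simp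

lift_definition plus_ell2 :: "'a ell2 \<Rightarrow> 'a ell2 \<Rightarrow> 'a ell2"
  is "\<lambda>f g x. f x + g x" by (rule ell2_add(1))

lift_definition uminus_ell2 :: "'a ell2 \<Rightarrow> 'a ell2" is "\<lambda>f x. - f x" by simp

lift_definition minus_ell2 :: "'a ell2 \<Rightarrow> 'a ell2 \<Rightarrow> 'a ell2"
  is "\<lambda>f g x. f x - g x"
proof -
  fix f g :: "'a \<Rightarrow> complex"
  assume "(\<lambda>x. (cmod (f x))\<^sup>2) summable_on UNIV" "(\<lambda>x. (cmod (g x))\<^sup>2) summable_on UNIV"
  then show "(\<lambda>x. (cmod (f x - g x))\<^sup>2) summable_on UNIV"
    using ell2_add(1)[of f "\<lambda>x. - g x"] by simp
qed

lift_definition scaleR_ell2 :: "real \<Rightarrow> 'a ell2 \<Rightarrow> 'a ell2"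
  is "\<lambda>r f x. of_real r * f x" by (rule ell2_scale)

lift_definition norm_ell2 :: "'a ell2 \<Rightarrow> real"
  is "\<lambda>f. sqrt (\<Sum>\<^sub>\<infinity>x. (cmod (f x))\<^sup>2)" .

definition dist_ell2 :: "'a ell2 \<Rightarrow> 'a ell2 \<Rightarrow> real"
  where "dist_ell2 f g = norm (f - g)"

definition sgn_ell2 :: "'a ell2 \<Rightarrow> 'a ell2"
  where "sgn_ell2 f = inverse (norm f) *\<^sub>R f"

definition uniformity_ell2 :: "('a ell2 \<times> 'a ell2) filter"
  where "uniformity_ell2 = (INF e\<in>{0<..}. principal {(x, y). dist x y < e})"

definition open_ell2 :: "'a ell2 set \<Rightarrow> bool"
  where "open_ell2 U \<longleftrightarrow> (\<forall>x\<in>U. \<forall>\<^sub>F (x', y) in uniformity. x' = x \<longrightarrow> y \<in> U)"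

instance
proof
  fix a b c :: "'a ell2" and r s :: real
  show "a + b + c = a + (b + c)" by transfer (simp add: add.assoc)
  show "a + b = b + a" by transfer (simp add: add.commute)
  show "0 + a = a" by transfer simp
  show "- a + a = 0" by transfer simp
  show "a - b = a + - b" by transfer simp
  show "r *\<^sub>R (a + b) = r *\<^sub>R a + r *\<^sub>R b" by transfer (simp add: algebra_simps)
  show "(r + s) *\<^sub>R a = r *\<^sub>R a + s *\<^sub>R a" by transfer (simp add: algebra_simps)
  show "r *\<^sub>R s *\<^sub>R a = (r * s) *\<^sub>R a" by transfer (simp add: algebra_simps)
  show "1 *\<^sub>R a = a" by transfer simp
  show "dist a b = norm (a - b)" by (rule dist_ell2_def)
  show "sgn a = inverse (norm a) *\<^sub>R a" by (rule sgn_ell2_def)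
  show "uniformity = (INF e\<in>{0<..}. principal {(x :: 'a ell2, y). dist x y < e})"
    by (rule uniformity_ell2_def)
  show "open U \<longleftrightarrow> (\<forall>x\<in>U. \<forall>\<^sub>F (x', y) in uniformity. x' = x \<longrightarrow> y \<in> U)" for U :: "'a ell2 set"
    by (rule open_ell2_def)
  show "norm a = 0 \<longleftrightarrow> a = 0"
  proof transfer
    fix f :: "'a \<Rightarrow> complex"
    assume f: "(\<lambda>x. (cmod (f x))\<^sup>2) summable_on UNIV"
    show "sqrt (\<Sum>\<^sub>\<infinity>x. (cmod (f x))\<^sup>2) = 0 \<longleftrightarrow> f = (\<lambda>_. 0)"
    proof
      assume "sqrt (\<Sum>\<^sub>\<infinity>x. (cmod (f x))\<^sup>2) = 0"
      then have le: "(\<Sum>\<^sub>\<infinity>x. (cmod (f x))\<^sup>2) \<le> 0"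
        by (simp only: real_sqrt_eq_0_iff)
      have "(cmod (f x))\<^sup>2 = 0" for x
        by (rule nonneg_infsum_le_0D[OF le f]) simp_all
      then show "f = (\<lambda>_. 0)"
        by (intro ext) (metis norm_eq_zero power_eq_0_iff)
    next
      assume "f = (\<lambda>_. 0)"
      then show "sqrt (\<Sum>\<^sub>\<infinity>x. (cmod (f x))\<^sup>2) = 0" by simp
    qed
  qed
  show "norm (a + b) \<le> norm a + norm b" by transfer (rule ell2_add(2))
  show "norm (r *\<^sub>R a) = \<bar>r\<bar> * norm a"
  proof transfer
    fix t :: real and f :: "'a \<Rightarrow> complex"
    have "(\<Sum>\<^sub>\<infinity>x. (cmod (of_real t * f x))\<^sup>2) = (\<Sum>\<^sub>\<infinity>x. t\<^sup>2 * (cmod (f x))\<^sup>2)"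
      by (simp only: norm_mult norm_of_real power_mult_distrib power2_abs)
    also have "\<dots> = t\<^sup>2 * (\<Sum>\<^sub>\<infinity>x. (cmod (f x))\<^sup>2)"
      by (rule infsum_cmult_right')
    finally show "sqrt (\<Sum>\<^sub>\<infinity>x. (cmod (of_real t * f x))\<^sup>2)
                    = \<bar>t\<bar> * sqrt (\<Sum>\<^sub>\<infinity>x. (cmod (f x))\<^sup>2)"
      by (simp only: real_sqrt_mult real_sqrt_abs)
  qed
qed

end

lift_definition basis_ell2 :: "'a \<Rightarrow> 'a ell2"
  is "\<lambda>a x. if x = a then 1 else 0"
proof -
  fix a :: 'a
  show "(\<lambda>x. (cmod (if x = a then 1 else 0))\<^sup>2) summable_on UNIV"
    by (subst summable_on_cong_neutral[where S = UNIV and T = "{a}" and g = "\<lambda>_. 1"]) auto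
qed

text \<open>
  The \<open>N \<ge> 1\<close> generators are the elements of an arbitrary finite type \<open>'n\<close>; the free semigroup
  is \<open>'n list\<close> with \<open>[]\<close> as unit and \<open>@\<close> as multiplication. The Hilbert space
  direct sum of the \<open>\<H>\<^sub>k\<close> is \<open>'n list ell2\<close>, with \<open>\<H>\<^sub>k\<close> spanned by
  the \<open>basis_ell2 \<sigma>\<close> with \<open>length \<sigma> = k\<close>.

  An operator from \<open>\<H>\<^sub>j\<close> to \<open>\<H>\<^sub>i\<close> is given by its matrix in the bases of words, indexed (row, column)
  by words of length \<open>i\<close> and \<open>j\<close> and set to \<open>0\<close> at all other pairs of words.
\<close>

type_synonym 'n block = "'n list \<Rightarrow> 'n list \<Rightarrow> complex"

type_synonym 'n opmat = "nat \<Rightarrow> nat \<Rightarrow> 'n block"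

definition blocks :: "nat \<Rightarrow> nat \<Rightarrow> 'n block set" where
  "blocks j i = {R. \<forall>\<sigma> \<tau>. \<not> (length \<sigma> = i \<and> length \<tau> = j) \<longrightarrow> R \<sigma> \<tau> = 0}"

definition zero_block :: "'n block" where
  "zero_block = (\<lambda>_ _. 0)"

text \<open>The direct sum of \<open>N\<close> copies of an operator: \<open>e\<^bsub>a\<sigma>\<^esub>\<close> is \<open>e\<^bsub>\<sigma>\<^esub>\<close> in the copy with label \<open>a\<close>.\<close>

fun direct_sum :: "'n block \<Rightarrow> 'n block" where
  "direct_sum R (a # \<sigma>) (b # \<tau>) = (if a = b then R \<sigma> \<tau> else 0)"
| "direct_sum R _ _ = 0"

definition entry :: "('n list ell2 \<Rightarrow>\<^sub>L 'n list ell2) \<Rightarrow> 'n opmat" where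
  "entry T i j = (\<lambda>\<sigma> \<tau>. if length \<sigma> = i \<and> length \<tau> = j
                         then coord (blinfun_apply T (basis_ell2 \<tau>)) \<sigma> else 0)"

text \<open>Bounded linear functions are only real linear, so complex linearity is imposed separately.\<close>

definition Schur_class :: "('n::finite list ell2 \<Rightarrow>\<^sub>L 'n list ell2) set" where
  "Schur_class = {T.
     (\<forall>c f. blinfun_apply T (cscale c f) = cscale c (blinfun_apply T f)) \<and>
     norm T \<le> 1 \<and>
     (\<forall>i j. i > j \<longrightarrow> entry T i j = zero_block) \<and>
     (\<forall>i j. 1 \<le> i \<and> i \<le> j \<longrightarrow> entry T i j = direct_sum (entry T (i - 1) (j - 1)))}"

definition Schur_class0 :: "('n::finite list ell2 \<Rightarrow>\<^sub>L 'n list ell2) set" where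
  "Schur_class0 = {T \<in> Schur_class. entry T 0 0 = zero_block}"

definition positive_definite_kernel :: "('w \<Rightarrow> 'w \<Rightarrow> complex) \<Rightarrow> bool" where
  "positive_definite_kernel K \<longleftrightarrow>
     (\<forall>m\<ge>1. \<forall>(\<sigma> :: nat \<Rightarrow> 'w) (c :: nat \<Rightarrow> complex).
        0 \<le> (\<Sum>i = 1..m. \<Sum>j = 1..m. K (\<sigma> i) (\<sigma> j) * c j * cnj (c i)))"

definition multi_Toeplitz :: "('n list \<Rightarrow> 'n list \<Rightarrow> complex) \<Rightarrow> bool" where
  "multi_Toeplitz K \<longleftrightarrow>
     (\<forall>\<tau> \<sigma> \<sigma>'. K (\<tau> @ \<sigma>) (\<tau> @ \<sigma>') = K \<sigma> \<sigma>') \<and>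
     (\<forall>\<sigma> \<tau>. \<not> (\<exists>\<alpha>. \<sigma> = \<tau> @ \<alpha> \<or> \<tau> = \<sigma> @ \<alpha>) \<longrightarrow> K \<sigma> \<tau> = 0)"

definition kernel_block :: "('n list \<Rightarrow> 'n list \<Rightarrow> complex) \<Rightarrow> 'n opmat" where
  "kernel_block K i j = (\<lambda>\<sigma> \<tau>. if length \<sigma> = i \<and> length \<tau> = j then K \<sigma> \<tau> else 0)"

text \<open>
  A row \<open>(x\<^sub>0, \<dots>, x\<^sub>n)\<close> has \<open>x\<^sub>j\<close> an operator from \<open>\<H>\<^sub>j\<close> to \<open>\<complex> = \<H>\<^sub>0\<close>; to represent each row
  uniquely, it is continued by \<open>0\<close> beyond \<open>n\<close>.
\<close>

definition rows :: "nat \<Rightarrow> (nat \<Rightarrow> 'n block) set" where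
  "rows n = {x. (\<forall>j\<le>n. x j \<in> blocks j 0) \<and> (\<forall>j>n. x j = zero_block)}"

fun U :: "(nat \<Rightarrow> 'n block) \<Rightarrow> 'n opmat" where
  "U x 0 j = x j"
| "U x (Suc i) 0 = zero_block"
| "U x (Suc i) (Suc j) = direct_sum (U x i j)"

text \<open>Product of operators on the direct sum of \<open>\<H>\<^sub>0, \<dots>, \<H>\<^sub>n\<close>.\<close>

definition opmat_mult :: "nat \<Rightarrow> 'n::finite opmat \<Rightarrow> 'n opmat \<Rightarrow> 'n opmat" where
  "opmat_mult n A B i j =
     (\<lambda>\<sigma> \<tau>. \<Sum>k\<le>n. \<Sum>\<rho> | length \<rho> = k. A i k \<sigma> \<rho> * B k j \<rho> \<tau>)"

definition opmat_eq :: "nat \<Rightarrow> 'n opmat \<Rightarrow> 'n opmat \<Rightarrow> bool" where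
  "opmat_eq n A B \<longleftrightarrow> (\<forall>i\<le>n. \<forall>j\<le>n. A i j = B i j)"

definition x_row :: "('n list \<Rightarrow> 'n list \<Rightarrow> complex) \<Rightarrow> nat \<Rightarrow> nat \<Rightarrow> 'n block" where
  "x_row K n j =
     (if j = 0 then (\<lambda>\<sigma> \<tau>. if \<sigma> = [] \<and> \<tau> = [] then 1 else 0)
      else if j \<le> n then kernel_block K 0 j else zero_block)"

definition y_row :: "('n list \<Rightarrow> 'n list \<Rightarrow> complex) \<Rightarrow> nat \<Rightarrow> nat \<Rightarrow> 'n block" where
  "y_row K n j =
     (if j = 0 then zero_block else if j \<le> n then kernel_block K 0 j else zero_block)"

definition z_row :: "('n::finite list \<Rightarrow> 'n list \<Rightarrow> complex) \<Rightarrow> nat \<Rightarrow> nat \<Rightarrow> 'n block" where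
  "z_row K n =
     (THE z. z \<in> rows n \<and> opmat_eq n (U (y_row K n)) (opmat_mult n (U z) (U (x_row K n))))"

definition T_of :: "('n::finite list \<Rightarrow> 'n list \<Rightarrow> complex) \<Rightarrow> 'n list ell2 \<Rightarrow>\<^sub>L 'n list ell2" where
  "T_of K = (THE T. T \<in> Schur_class \<and> (\<forall>n\<ge>1. opmat_eq n (entry T) (U (z_row K n))))"

end

theory Submission
  imports Defs "HOL-Library.Sublist"
begin

text \<open>
  Upper triangular operators built from a row by taking direct sums are the Toeplitz matrices of
  functions on the free semigroup, and multiplying them amounts to convolving the functions; the
  functions with value \<open>1\<close> at the empty word form a group. With \<open>s = K(\<emptyset>, \<cdot>)\<close> and the unit mass
  \<open>\<delta>\<close>, the defining equation \<open>s - \<delta> = z * s\<close> reads \<open>z = \<delta> - s\<^sup>-\<^sup>1\<close>, so \<open>s\<close> and \<open>z\<close> determine each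
  other. If \<open>X\<close> and \<open>Z\<close> are the matrices of \<open>s\<close> and \<open>z\<close> on words of length at most \<open>n\<close>, the
  compression of \<open>K\<close> is \<open>X\<^sup>* (1 - Z\<^sup>* Z) X\<close> with \<open>X\<close> invertible. Hence \<open>K\<close> is positive definite
  iff all \<open>Z\<close> are contractions, that is, iff they are the compressions of a contraction on the
  whole space, which is unique because finitely supported vectors are dense.
\<close>

section \<open>Square-summable families and contractive matrices\<close>

definition finite_ell2 :: "'a set \<Rightarrow> ('a \<Rightarrow> complex) \<Rightarrow> 'a ell2" where
  "finite_ell2 A c = (\<Sum>a\<in>A. cscale (c a) (basis_ell2 a))"

section \<open>Coordinates, norms and finitely supported vectors\<close>

lemma coord_basis_ell2: "coord (basis_ell2 a) x = (if x = a then 1 else 0)"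
  by transfer simp

lemma coord_cscale: "coord (cscale c f) x = c * coord f x"
  by transfer simp

lemma coord_zero: "coord 0 x = 0"
  by transfer simp

lemma coord_add: "coord (f + g) x = coord f x + coord g x"
  by transfer simp

lemma coord_diff: "coord (f - g) x = coord f x - coord g x"
  by transfer simp

lemma coord_scaleR: "coord (r *\<^sub>R f) x = r * coord f x"
  by transfer simp

lemma coord_sum: "coord (\<Sum>a\<in>A. f a) x = (\<Sum>a\<in>A. coord (f a) x)"
  by (induction A rule: infinite_finite_induct) (auto simp: coord_zero coord_add)

lemma ell2_eqI: "(\<And>x. coord f x = coord g x) \<Longrightarrow> f = g"
  by (metis coord_inject ext)

lemma coord_summable: "(\<lambda>x. (cmod (coord f x))\<^sup>2) summable_on UNIV"
  using coord[of f] by simp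

lemma norm_ell2_square: "(norm f)\<^sup>2 = (\<Sum>\<^sub>\<infinity>x. (cmod (coord f x))\<^sup>2)"
  by transfer (simp add: infsum_nonneg)

lemma sum_coord_le_norm_square:
  "finite A \<Longrightarrow> (\<Sum>x\<in>A. (cmod (coord f x))\<^sup>2) \<le> (norm f)\<^sup>2"
  unfolding norm_ell2_square by (intro finite_sum_le_infsum coord_summable) auto

lemma coord_finite_ell2:
  "finite A \<Longrightarrow> coord (finite_ell2 A c) x = (if x \<in> A then c x else 0)"
  by (simp add: finite_ell2_def coord_sum coord_cscale coord_basis_ell2 if_distrib[of "\<lambda>u. _ * u"]
      cong: if_cong)

lemma norm_finite_ell2:
  assumes "finite A"
  shows "(norm (finite_ell2 A c))\<^sup>2 = (\<Sum>x\<in>A. (cmod (c x))\<^sup>2)"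
proof -
  have "(\<Sum>\<^sub>\<infinity>x. (cmod (coord (finite_ell2 A c) x))\<^sup>2) = (\<Sum>\<^sub>\<infinity>x\<in>A. (cmod (c x))\<^sup>2)"
    by (rule infsum_cong_neutral) (auto simp: coord_finite_ell2 assms)
  then show ?thesis by (simp add: norm_ell2_square assms)
qed

lemma norm_diff_finite_ell2:
  assumes "finite A"
  shows "(norm (f - finite_ell2 A (coord f)))\<^sup>2 = (norm f)\<^sup>2 - (\<Sum>x\<in>A. (cmod (coord f x))\<^sup>2)"
proof -
  have "(\<Sum>\<^sub>\<infinity>x. (cmod (coord (f - finite_ell2 A (coord f)) x))\<^sup>2)
      = (\<Sum>\<^sub>\<infinity>x\<in>UNIV - A. (cmod (coord f x))\<^sup>2)"
    by (rule infsum_cong_neutral) (auto simp: coord_diff coord_finite_ell2 assms)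
  also have "\<dots> = (\<Sum>\<^sub>\<infinity>x. (cmod (coord f x))\<^sup>2) - (\<Sum>\<^sub>\<infinity>x\<in>A. (cmod (coord f x))\<^sup>2)"
    by (rule infsum_Diff) (auto intro: coord_summable simp: assms)
  finally show ?thesis by (simp add: norm_ell2_square assms)
qed

text \<open>The squared error of the truncation to \<open>A\<close> is the total of the squared
  moduli minus the part over \<open>A\<close>, which tends to 0 along the finite sets. This is the
  density of finitely supported vectors.\<close>

lemma finite_ell2_tendsto:
  "((\<lambda>A. finite_ell2 A (coord f)) \<longlongrightarrow> f) (finite_subsets_at_top UNIV)"
proof -
  have "((\<lambda>A. \<Sum>x\<in>A. (cmod (coord f x))\<^sup>2) \<longlongrightarrow> (norm f)\<^sup>2) (finite_subsets_at_top UNIV)"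
    using has_sum_infsum[OF coord_summable[of f]] by (simp add: has_sum_def norm_ell2_square)
  then have "((\<lambda>A. sqrt ((norm f)\<^sup>2 - (\<Sum>x\<in>A. (cmod (coord f x))\<^sup>2))) \<longlongrightarrow> sqrt ((norm f)\<^sup>2 - (norm f)\<^sup>2))
      (finite_subsets_at_top UNIV)"
    by (intro tendsto_intros)
  moreover have "\<forall>\<^sub>F A in finite_subsets_at_top UNIV.
      sqrt ((norm f)\<^sup>2 - (\<Sum>x\<in>A. (cmod (coord f x))\<^sup>2)) = norm (f - finite_ell2 A (coord f))"
    by (rule eventually_finite_subsets_at_top_weakI) (simp flip: norm_diff_finite_ell2)
  ultimately have "((\<lambda>A. norm (f - finite_ell2 A (coord f))) \<longlongrightarrow> 0) (finite_subsets_at_top UNIV)"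
    by (simp add: tendsto_cong)
  then show ?thesis
    by (simp add: tendsto_iff dist_norm norm_minus_commute)
qed

section \<open>Complex-linear contractions and their matrices\<close>

definition complex_linear :: "('a ell2 \<Rightarrow>\<^sub>L 'a ell2) \<Rightarrow> bool" where
  "complex_linear T \<longleftrightarrow> (\<forall>c f. blinfun_apply T (cscale c f) = cscale c (blinfun_apply T f))"

lemma coord_apply_finite_ell2:
  assumes "complex_linear T"
  shows "coord (blinfun_apply T (finite_ell2 A c)) x
    = (\<Sum>a\<in>A. coord (blinfun_apply T (basis_ell2 a)) x * c a)"
  using assms
  by (simp add: finite_ell2_def blinfun.sum_right coord_sum complex_linear_def coord_cscale mult.commute)

text \<open>Complex linearity gives agreement on finitely supported vectors; continuity and their
  density give it everywhere.\<close>

lemma complex_linear_eqI: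
  assumes "complex_linear S" "complex_linear T"
    and eq: "\<And>a x. coord (blinfun_apply S (basis_ell2 a)) x = coord (blinfun_apply T (basis_ell2 a)) x"
  shows "S = T"
proof (rule blinfun_eqI)
  fix f
  have eq': "blinfun_apply S (finite_ell2 A (coord f)) = blinfun_apply T (finite_ell2 A (coord f))" for A
    by (rule ell2_eqI) (simp add: coord_apply_finite_ell2 assms)
  have S: "((\<lambda>A. blinfun_apply S (finite_ell2 A (coord f))) \<longlongrightarrow> blinfun_apply S f)
      (finite_subsets_at_top UNIV)"
    and T: "((\<lambda>A. blinfun_apply T (finite_ell2 A (coord f))) \<longlongrightarrow> blinfun_apply T f)
      (finite_subsets_at_top UNIV)"
    by (intro tendsto_intros finite_ell2_tendsto)+
  show "blinfun_apply S f = blinfun_apply T f"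
    by (rule tendsto_unique[OF _ S[unfolded eq'] T]) simp
qed

text \<open>Only finite sums occur, so the condition makes sense before any operator exists. Rows
  \<open>A\<close> and columns \<open>B\<close> vary independently, which allows a single row to be
  tested and \<open>B\<close> to exhaust the index type while \<open>A\<close> stays fixed.\<close>

definition contractive_matrix :: "('a \<Rightarrow> 'a \<Rightarrow> complex) \<Rightarrow> bool" where
  "contractive_matrix M \<longleftrightarrow> (\<forall>A B d. finite A \<longrightarrow> finite B \<longrightarrow>
     (\<Sum>x\<in>A. (cmod (\<Sum>y\<in>B. M x y * d y))\<^sup>2) \<le> (\<Sum>y\<in>B. (cmod (d y))\<^sup>2))"

lemma contractive_matrix_operator:
  assumes "complex_linear T" "norm T \<le> 1"
  shows "contractive_matrix (\<lambda>x y. coord (blinfun_apply T (basis_ell2 y)) x)"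
  unfolding contractive_matrix_def
proof (intro allI impI)
  fix A B :: "'a set" and d
  assume "finite A" "finite B"
  let ?v = "finite_ell2 B d"
  have "norm (blinfun_apply T ?v) \<le> norm ?v"
    using norm_blinfun[of T ?v] assms(2) mult_right_mono[OF assms(2), of "norm ?v"] by simp
  then have "(norm (blinfun_apply T ?v))\<^sup>2 \<le> (norm ?v)\<^sup>2"
    by (simp add: power_mono)
  then show "(\<Sum>x\<in>A. (cmod (\<Sum>y\<in>B. coord (blinfun_apply T (basis_ell2 y)) x * d y))\<^sup>2)
      \<le> (\<Sum>y\<in>B. (cmod (d y))\<^sup>2)"
    using sum_coord_le_norm_square[OF \<open>finite A\<close>, of "blinfun_apply T ?v"]
    by (simp add: coord_apply_finite_ell2 assms norm_finite_ell2 \<open>finite B\<close>)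
qed

text \<open>Applied to the conjugate of row \<open>x\<close> on \<open>B\<close>, with
  \<open>x\<close> as the only output coordinate, contractivity reads \<open>s^2 \<le> s\<close> for
  the squared row norm \<open>s\<close> over \<open>B\<close>; hence
  \<open>s \<le> 1\<close>.\<close>

lemma contractive_matrix_row_summable:
  assumes "contractive_matrix M"
  shows "(\<lambda>y. (cmod (M x y))\<^sup>2) summable_on UNIV"
proof (rule nonneg_bdd_above_summable_on)
  have "(\<Sum>y\<in>B. (cmod (M x y))\<^sup>2) \<le> 1" if "finite B" for B
  proof -
    let ?s = "\<Sum>y\<in>B. (cmod (M x y))\<^sup>2"
    have "(\<Sum>y\<in>B. M x y * cnj (M x y)) = of_real ?s"
      by (simp add: complex_norm_square del: of_real_power)
    then have "?s\<^sup>2 = (\<Sum>x\<in>{x}. (cmod (\<Sum>y\<in>B. M x y * cnj (M x y)))\<^sup>2)"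
      by (simp del: of_real_sum)
    also have "\<dots> \<le> (\<Sum>y\<in>B. (cmod (cnj (M x y)))\<^sup>2)"
      using assms[unfolded contractive_matrix_def, rule_format, of "{x}" B "\<lambda>y. cnj (M x y)"] that
      by simp
    finally have "?s * ?s \<le> 1 * ?s" by (simp add: power2_eq_square)
    moreover have "0 \<le> ?s" by (simp add: sum_nonneg)
    ultimately show ?thesis
      using mult_right_le_imp_le[of ?s ?s 1] by (cases "?s = 0") auto
  qed
  then show "bdd_above (sum (\<lambda>y. (cmod (M x y))\<^sup>2) ` {F. F \<subseteq> UNIV \<and> finite F})"
    by (intro bdd_aboveI2[where M = 1]) auto
qed simp

lemma contractive_matrix_apply_summable:
  assumes "contractive_matrix M"
  shows "(\<lambda>y. M x y * coord f y) summable_on UNIV"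
proof (rule abs_summable_summable, rule summable_on_comparison_test)
  show "(\<lambda>y. (cmod (M x y))\<^sup>2 + (cmod (coord f y))\<^sup>2) summable_on UNIV"
    by (intro summable_on_add contractive_matrix_row_summable[OF assms] coord_summable)
  show "cmod (M x y * coord f y) \<le> (cmod (M x y))\<^sup>2 + (cmod (coord f y))\<^sup>2" for y
    using sum_squares_bound[of "cmod (M x y)" "cmod (coord f y)"]
      mult_nonneg_nonneg[OF norm_ge_zero norm_ge_zero, of "M x y" "coord f y"]
    unfolding norm_mult by linarith
qed simp

text \<open>The finite inequality for the restriction of \<open>f\<close> to \<open>B\<close> passes
  to the limit in \<open>B\<close>, since only the finitely many output coordinates in
  \<open>A\<close> are involved.\<close>

lemma contractive_matrix_apply_bound:
  assumes "contractive_matrix M" "finite A"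
  shows "(\<Sum>x\<in>A. (cmod (\<Sum>\<^sub>\<infinity>y. M x y * coord f y))\<^sup>2) \<le> (norm f)\<^sup>2"
proof (rule tendsto_upperbound)
  show "((\<lambda>B. \<Sum>x\<in>A. (cmod (\<Sum>y\<in>B. M x y * coord f y))\<^sup>2)
      \<longlongrightarrow> (\<Sum>x\<in>A. (cmod (\<Sum>\<^sub>\<infinity>y. M x y * coord f y))\<^sup>2)) (finite_subsets_at_top UNIV)"
    using has_sum_infsum[OF contractive_matrix_apply_summable[OF assms(1)]]
    by (intro tendsto_intros) (simp add: has_sum_def)
  show "\<forall>\<^sub>F B in finite_subsets_at_top UNIV.
      (\<Sum>x\<in>A. (cmod (\<Sum>y\<in>B. M x y * coord f y))\<^sup>2) \<le> (norm f)\<^sup>2"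
  proof (rule eventually_finite_subsets_at_top_weakI)
    fix B :: "'a set" assume "finite B"
    then have "(\<Sum>x\<in>A. (cmod (\<Sum>y\<in>B. M x y * coord f y))\<^sup>2) \<le> (\<Sum>y\<in>B. (cmod (coord f y))\<^sup>2)"
      using assms by (simp add: contractive_matrix_def)
    also have "\<dots> \<le> (norm f)\<^sup>2" by (rule sum_coord_le_norm_square[OF \<open>finite B\<close>])
    finally show "(\<Sum>x\<in>A. (cmod (\<Sum>y\<in>B. M x y * coord f y))\<^sup>2) \<le> (norm f)\<^sup>2" .
  qed
qed simp

lemma operator_of_contractive_matrix:
  fixes M :: "'a \<Rightarrow> 'a \<Rightarrow> complex"
  assumes M: "contractive_matrix M"
  obtains T where "complex_linear T" "norm T \<le> 1"
    "\<And>a x. coord (blinfun_apply T (basis_ell2 a)) x = M x a"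
proof -
  define g where "g f = (\<lambda>x. \<Sum>\<^sub>\<infinity>y. M x y * coord f y)" for f :: "'a ell2"
  \<comment> \<open>A bound uniform in the finite set \<open>A\<close> yields both that
    \<open>g f\<close> is square summable and that its norm is at most that of
    \<open>f\<close>.\<close>
  have L2: "L2_set (\<lambda>x. cmod (g f x)) A \<le> norm f" if "finite A" for A f
    unfolding L2_set_def g_def
    by (rule real_le_lsqrt) (use contractive_matrix_apply_bound[OF M that] in \<open>auto intro: sum_nonneg\<close>)
  define t where "t f = Abs_ell2 (g f)" for f
  have coord_t: "coord (t f) x = (\<Sum>\<^sub>\<infinity>y. M x y * coord f y)" for f x
    unfolding t_def using ell2_bounded(1)[OF L2] by (simp add: Abs_ell2_inverse) (simp add: g_def)
  have norm_t: "norm (t f) \<le> norm f" for f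
    using ell2_bounded(2)[OF L2, of f]
    by (simp add: norm_ell2.rep_eq coord_t[abs_def] g_def)
  note summ = contractive_matrix_apply_summable[OF M]
  have cs: "t (cscale c f) = cscale c (t f)" for c f
    by (rule ell2_eqI) (simp add: coord_t coord_cscale mult.left_commute infsum_cmult_right')
  have "bounded_linear t"
  proof (rule bounded_linear_intro[where K = 1])
    show "t (f + h) = t f + t h" for f h
      by (rule ell2_eqI) (simp add: coord_t coord_add distrib_left infsum_add summ)
    show "t (r *\<^sub>R f) = r *\<^sub>R t f" for r f
      by (rule ell2_eqI) (simp add: coord_t coord_scaleR mult.left_commute infsum_cmult_right')
    show "norm (t f) \<le> norm f * 1" for f using norm_t by simp
  qed
  then have [simp]: "blinfun_apply (Blinfun t) = t" by (rule bounded_linear_Blinfun_apply)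
  show thesis
  proof
    show "complex_linear (Blinfun t)" by (simp add: complex_linear_def cs)
    show "norm (Blinfun t) \<le> 1" by (rule norm_blinfun_bound) (use norm_t in auto)
    fix a x
    have "(\<Sum>\<^sub>\<infinity>y. M x y * coord (basis_ell2 a) y) = (\<Sum>\<^sub>\<infinity>y\<in>{a}. M x y)"
      by (rule infsum_cong_neutral) (auto simp: coord_basis_ell2)
    then show "coord (blinfun_apply (Blinfun t) (basis_ell2 a)) x = M x a"
      by (simp add: coord_t)
  qed
qed

section \<open>Convolution on the free semigroup\<close>

text \<open>The upper triangular matrix with row \<open>f\<close> at the empty word that is
  invariant under prefixing both indices with a common word. All blocks are kept in one matrix over
  words.\<close>

definition toeplitz :: "('n list \<Rightarrow> complex) \<Rightarrow> 'n list \<Rightarrow> 'n list \<Rightarrow> complex" where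
  "toeplitz f \<sigma> \<tau> = (if prefix \<sigma> \<tau> then f (drop (length \<sigma>) \<tau>) else 0)"

text \<open>The product of formal power series in noncommuting variables: the sum runs over all ways
  to cut the word in two.\<close>

definition convolution :: "('n list \<Rightarrow> complex) \<Rightarrow> ('n list \<Rightarrow> complex) \<Rightarrow> 'n list \<Rightarrow> complex" where
  "convolution f g \<tau> = (\<Sum>k\<le>length \<tau>. f (take k \<tau>) * g (drop k \<tau>))"

definition unit_mass :: "'n list \<Rightarrow> complex" where
  "unit_mass \<tau> = (if \<tau> = [] then 1 else 0)"

definition words :: "nat \<Rightarrow> 'n list set" where
  "words n = {\<tau>. length \<tau> \<le> n}"

lemma finite_words: "finite (words n :: 'n::finite list set)"
  using finite_lists_length_le[of "UNIV :: 'n set" n] by (simp add: words_def)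

lemma finite_subset_words:
  assumes "finite A"
  obtains n where "A \<subseteq> words n"
proof -
  from assms have "finite (length ` A)" by simp
  then obtain n where "\<forall>k\<in>length ` A. k \<le> n" using finite_nat_set_iff_bounded_le by blast
  then show thesis by (intro that[of n]) (auto simp: words_def)
qed

lemma prefix_words: "prefix \<rho> \<tau> \<Longrightarrow> \<tau> \<in> words n \<Longrightarrow> \<rho> \<in> words n"
  by (auto simp: words_def dest: prefix_length_le)

lemma toeplitz_Nil: "toeplitz f [] \<tau> = f \<tau>"
  by (simp add: toeplitz_def)

lemma toeplitz_append: "toeplitz f (\<rho> @ \<sigma>) (\<rho> @ \<tau>) = toeplitz f \<sigma> \<tau>"
  by (simp add: toeplitz_def)

lemma toeplitz_Cons_Cons: "toeplitz f (a # \<sigma>) (b # \<tau>) = (if a = b then toeplitz f \<sigma> \<tau> else 0)"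
  by (simp add: toeplitz_def)

lemma toeplitz_unit_mass: "toeplitz unit_mass \<sigma> \<tau> = (if \<sigma> = \<tau> then 1 else 0)"
  by (auto simp: toeplitz_def unit_mass_def prefix_def)

lemma toeplitz_diff: "toeplitz (\<lambda>\<tau>. f \<tau> - g \<tau>) \<sigma> \<tau> = toeplitz f \<sigma> \<tau> - toeplitz g \<sigma> \<tau>"
  by (simp add: toeplitz_def)

lemma prefixes_eq_takes: "{\<rho>. prefix \<rho> \<tau>} = (\<lambda>k. take k \<tau>) ` {..length \<tau>}"
proof (intro set_eqI iffI)
  fix \<rho> assume "\<rho> \<in> {\<rho>. prefix \<rho> \<tau>}"
  then show "\<rho> \<in> (\<lambda>k. take k \<tau>) ` {..length \<tau>}"
    by (intro image_eqI[of _ _ "length \<rho>"]) (auto simp: prefix_def)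
qed (auto simp: take_is_prefix)

lemma inj_on_take: "inj_on (\<lambda>k. take k \<tau>) {..length \<tau>}"
  by (rule inj_on_inverseI[where g = length]) simp

lemma convolution_eq_sum:
  assumes "finite A" "{\<rho>. prefix \<rho> \<tau>} \<subseteq> A"
  shows "convolution f g \<tau> = (\<Sum>\<rho>\<in>A. f \<rho> * toeplitz g \<rho> \<tau>)"
proof -
  have "(\<Sum>\<rho>\<in>A. f \<rho> * toeplitz g \<rho> \<tau>) = (\<Sum>\<rho>\<in>{\<rho>. prefix \<rho> \<tau>}. f \<rho> * toeplitz g \<rho> \<tau>)"
    using assms by (intro sum.mono_neutral_right) (auto simp: toeplitz_def)
  also have "\<dots> = (\<Sum>k\<le>length \<tau>. f (take k \<tau>) * toeplitz g (take k \<tau>) \<tau>)"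
    unfolding prefixes_eq_takes by (simp add: sum.reindex inj_on_take)
  also have "\<dots> = convolution f g \<tau>"
    unfolding convolution_def by (intro sum.cong) (auto simp: toeplitz_def take_is_prefix)
  finally show ?thesis by simp
qed

text \<open>Only words \<rho> between \<sigma> and \<tau> in the prefix order contribute. With
  \<open>\<tau> = \<sigma> @ \<alpha>\<close> and \<open>\<rho> = \<sigma> @ \<beta>\<close>, the
  sum becomes the convolution at \<alpha>. Since \<open>A\<close> need only contain the prefixes of
  \<tau>, this covers compressions to \<open>words n\<close>.\<close>

lemma toeplitz_convolution:
  assumes A: "finite A" "{\<rho>. prefix \<rho> \<tau>} \<subseteq> A"
  shows "(\<Sum>\<rho>\<in>A. toeplitz f \<sigma> \<rho> * toeplitz g \<rho> \<tau>) = toeplitz (convolution f g) \<sigma> \<tau>"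
proof (cases "prefix \<sigma> \<tau>")
  case True
  then obtain \<alpha> where \<tau>: "\<tau> = \<sigma> @ \<alpha>" by (auto simp: prefix_def)
  have fin: "finite {\<beta>. prefix \<beta> \<alpha>}" by (simp add: prefixes_eq_takes)
  have "(\<Sum>\<rho>\<in>A. toeplitz f \<sigma> \<rho> * toeplitz g \<rho> \<tau>)
      = (\<Sum>\<rho>\<in>(@) \<sigma> ` {\<beta>. prefix \<beta> \<alpha>}. toeplitz f \<sigma> \<rho> * toeplitz g \<rho> \<tau>)"
  proof (rule sum.mono_neutral_right[OF A(1)])
    show "(@) \<sigma> ` {\<beta>. prefix \<beta> \<alpha>} \<subseteq> A" using A(2) by (auto simp: \<tau>)
    show "\<forall>\<rho>\<in>A - (@) \<sigma> ` {\<beta>. prefix \<beta> \<alpha>}. toeplitz f \<sigma> \<rho> * toeplitz g \<rho> \<tau> = 0"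
      by (auto simp: toeplitz_def \<tau> prefix_def)
  qed
  also have "\<dots> = (\<Sum>\<beta>\<in>{\<beta>. prefix \<beta> \<alpha>}. f \<beta> * toeplitz g \<beta> \<alpha>)"
    by (subst sum.reindex)
      (auto simp: inj_on_def \<tau> toeplitz_append toeplitz_append[of _ _ "[]", simplified] toeplitz_Nil)
  also have "\<dots> = toeplitz (convolution f g) \<sigma> \<tau>"
    by (subst convolution_eq_sum[OF fin, symmetric]) (auto simp: \<tau> toeplitz_def)
  finally show ?thesis .
next
  case False
  then have "toeplitz f \<sigma> \<rho> * toeplitz g \<rho> \<tau> = 0" for \<rho>
    by (auto simp: toeplitz_def dest: prefix_order.trans)
  then have "(\<Sum>\<rho>\<in>A. toeplitz f \<sigma> \<rho> * toeplitz g \<rho> \<tau>) = 0"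
    by (intro sum.neutral ballI)
  with False show ?thesis by (simp add: toeplitz_def)
qed

lemma toeplitz_apply_convolution:
  assumes "finite A" "\<And>\<tau>. \<tau> \<in> A \<Longrightarrow> {\<rho>. prefix \<rho> \<tau>} \<subseteq> A"
  shows "(\<Sum>\<rho>\<in>A. toeplitz f \<sigma> \<rho> * (\<Sum>\<tau>\<in>A. toeplitz g \<rho> \<tau> * c \<tau>))
    = (\<Sum>\<tau>\<in>A. toeplitz (convolution f g) \<sigma> \<tau> * c \<tau>)"
proof -
  have "(\<Sum>\<rho>\<in>A. toeplitz f \<sigma> \<rho> * (\<Sum>\<tau>\<in>A. toeplitz g \<rho> \<tau> * c \<tau>))
      = (\<Sum>\<tau>\<in>A. (\<Sum>\<rho>\<in>A. toeplitz f \<sigma> \<rho> * toeplitz g \<rho> \<tau>) * c \<tau>)"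
    by (simp add: sum_distrib_left sum_distrib_right mult.assoc) (rule sum.swap)
  then show ?thesis using toeplitz_convolution[OF assms] by simp
qed

text \<open>Associativity of matrix multiplication: the prefixes of \<tau> form a finite set closed
  under prefixes, so one index set serves both sums and they can be swapped.\<close>

lemma convolution_assoc:
  "convolution (convolution f g) h = convolution f (convolution g h)"
proof
  fix \<tau> :: "'a list"
  let ?A = "{\<rho>. prefix \<rho> \<tau>}"
  have A: "finite ?A" by (simp add: prefixes_eq_takes)
  have sub: "{\<rho>'. prefix \<rho>' \<rho>} \<subseteq> ?A" if "\<rho> \<in> ?A" for \<rho>
    using that by (auto dest: prefix_order.trans)
  have "convolution (convolution f g) h \<tau>
      = (\<Sum>\<rho>\<in>?A. (\<Sum>\<rho>'\<in>?A. f \<rho>' * toeplitz g \<rho>' \<rho>) * toeplitz h \<rho> \<tau>)"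
    unfolding convolution_eq_sum[OF A subset_refl, of "convolution f g"]
    by (intro sum.cong refl arg_cong2[where f = times] convolution_eq_sum[OF A sub])
  also have "\<dots> = (\<Sum>\<rho>'\<in>?A. f \<rho>' * (\<Sum>\<rho>\<in>?A. toeplitz g \<rho>' \<rho> * toeplitz h \<rho> \<tau>))"
    by (simp add: sum_distrib_left sum_distrib_right mult.assoc) (rule sum.swap)
  also have "\<dots> = convolution f (convolution g h) \<tau>"
    by (simp only: toeplitz_convolution[OF A subset_refl] convolution_eq_sum[OF A subset_refl])
  finally show "convolution (convolution f g) h \<tau> = convolution f (convolution g h) \<tau>" .
qed

lemma convolution_unit_left: "convolution unit_mass f = f"
proof
  fix \<tau>
  have "convolution unit_mass f \<tau> = (\<Sum>k\<in>{0}. f (drop k \<tau>))"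
    unfolding convolution_def
    by (rule sum.mono_neutral_cong_right) (auto simp: unit_mass_def)
  then show "convolution unit_mass f \<tau> = f \<tau>" by simp
qed

lemma convolution_unit_right: "convolution f unit_mass = f"
proof
  fix \<tau>
  have "convolution f unit_mass \<tau> = (\<Sum>k\<in>{length \<tau>}. f (take k \<tau>))"
    unfolding convolution_def
    by (rule sum.mono_neutral_cong_right) (auto simp: unit_mass_def)
  then show "convolution f unit_mass \<tau> = f \<tau>" by simp
qed

lemma convolution_diff_left:
  "convolution (\<lambda>\<tau>. f \<tau> - g \<tau>) h \<tau> = convolution f h \<tau> - convolution g h \<tau>"
  by (simp add: convolution_def left_diff_distrib sum_subtractf)

lemma convolution_cong_words:
  assumes "\<And>\<tau>. \<tau> \<in> words n \<Longrightarrow> f \<tau> = f' \<tau>" "\<And>\<tau>. \<tau> \<in> words n \<Longrightarrow> g \<tau> = g' \<tau>" "\<tau> \<in> words n"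
  shows "convolution f g \<tau> = convolution f' g' \<tau>"
  using assms unfolding convolution_def by (intro sum.cong) (auto simp: words_def)

section \<open>Inverses under convolution\<close>

fun conv_inverse :: "('n list \<Rightarrow> complex) \<Rightarrow> 'n list \<Rightarrow> complex" where
  "conv_inverse f \<tau> =
     unit_mass \<tau> - (\<Sum>k<length \<tau>. conv_inverse f (take k \<tau>) * f (drop k \<tau>))"

declare conv_inverse.simps [simp del]

text \<open>The recursion solves this equation for the last summand, where the second factor is
  \<open>f [] = 1\<close>; all other summands involve shorter words. The recursive equation is
  applied by \<open>subst\<close>, as it would loop as a simp rule.\<close>

lemma conv_inverse_left:
  assumes "f [] = 1"
  shows "convolution (conv_inverse f) f = unit_mass"
proof
  fix \<tau>
  show "convolution (conv_inverse f) f \<tau> = unit_mass \<tau>"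
    unfolding convolution_def lessThan_Suc_atMost[symmetric] sum.lessThan_Suc
    by (subst (2) conv_inverse.simps) (use assms in \<open>simp\<close>)
qed

lemma conv_inverse_Nil: "conv_inverse f [] = 1"
  by (subst conv_inverse.simps) (simp add: unit_mass_def)

text \<open>Left inverses exist for every member of the monoid of functions with value 1 at the empty
  word, and again belong to it, so they are two-sided as in any group.\<close>

lemma conv_inverse_right:
  assumes "f [] = 1"
  shows "convolution f (conv_inverse f) = unit_mass"
proof -
  let ?g = "conv_inverse f" let ?h = "conv_inverse ?g"
  have hg: "convolution ?h ?g = unit_mass" by (simp add: conv_inverse_left conv_inverse_Nil)
  have "?h = convolution ?h (convolution ?g f)"
    by (simp add: conv_inverse_left assms convolution_unit_right)
  also have "\<dots> = f" by (simp add: hg convolution_unit_left flip: convolution_assoc)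
  finally show ?thesis using hg by simp
qed

text \<open>In \<open>h * (g * f) = (h * g) * f\<close>, with \<open>g\<close> the left inverse of
  \<open>f\<close> and \<open>h\<close> that of \<open>g\<close>, both inner products are the unit,
  so \<open>h = f\<close>.\<close>

lemma conv_inverse_inverse:
  assumes "f [] = 1"
  shows "conv_inverse (conv_inverse f) = f"
proof -
  have "conv_inverse (conv_inverse f) = convolution (conv_inverse (conv_inverse f)) (convolution (conv_inverse f) f)"
    by (simp add: conv_inverse_left assms convolution_unit_right)
  then show ?thesis
    by (simp add: conv_inverse_left conv_inverse_Nil convolution_unit_left flip: convolution_assoc)
qed

section \<open>Positive definite kernels and contractions\<close>

text \<open>Extending \<open>d\<close> by 0 and adding output coordinates reduces any
  \<open>A\<close>, \<open>B\<close> to a square test set \<open>C\<close>. This lets the sets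
  \<open>words n\<close> suffice.\<close>

lemma contractive_matrixI:
  assumes ex: "\<And>A. finite A \<Longrightarrow> \<exists>C. finite C \<and> A \<subseteq> C \<and>
    (\<forall>d. (\<Sum>x\<in>C. (cmod (\<Sum>y\<in>C. M x y * d y))\<^sup>2) \<le> (\<Sum>y\<in>C. (cmod (d y))\<^sup>2))"
  shows "contractive_matrix M"
  unfolding contractive_matrix_def
proof (intro allI impI)
  fix A B :: "'a set" and d :: "'a \<Rightarrow> complex"
  assume "finite A" "finite B"
  then obtain C where C: "finite C" "A \<union> B \<subseteq> C"
    and le: "\<And>d. (\<Sum>x\<in>C. (cmod (\<Sum>y\<in>C. M x y * d y))\<^sup>2) \<le> (\<Sum>y\<in>C. (cmod (d y))\<^sup>2)"
    using ex[of "A \<union> B"] by auto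
  let ?d = "\<lambda>y. if y \<in> B then d y else 0"
  have eq: "(\<Sum>y\<in>B. M x y * d y) = (\<Sum>y\<in>C. M x y * ?d y)" for x
    using C by (intro sum.mono_neutral_cong_left) auto
  have "(\<Sum>x\<in>A. (cmod (\<Sum>y\<in>B. M x y * d y))\<^sup>2) \<le> (\<Sum>x\<in>C. (cmod (\<Sum>y\<in>C. M x y * ?d y))\<^sup>2)"
    unfolding eq using C by (intro sum_mono2) auto
  also have "\<dots> \<le> (\<Sum>y\<in>C. (cmod (?d y))\<^sup>2)" by (rule le)
  also have "\<dots> = (\<Sum>y\<in>B. (cmod (d y))\<^sup>2)"
    using C by (intro sum.mono_neutral_cong_right) auto
  finally show "(\<Sum>x\<in>A. (cmod (\<Sum>y\<in>B. M x y * d y))\<^sup>2) \<le> (\<Sum>y\<in>B. (cmod (d y))\<^sup>2)" .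
qed

text \<open>The definition allows repetitions among the points. Collecting equal ones gives each
  point of \<open>C\<close> the sum of its coefficients, with 0 where no index hits it.\<close>

lemma positive_definite_kernelI:
  assumes ex: "\<And>A. finite A \<Longrightarrow> \<exists>C. finite C \<and> A \<subseteq> C \<and>
    (\<forall>c. 0 \<le> (\<Sum>x\<in>C. \<Sum>y\<in>C. K x y * c y * cnj (c x)))"
  shows "positive_definite_kernel K"
  unfolding positive_definite_kernel_def
proof (intro allI impI)
  fix m :: nat and \<sigma> :: "nat \<Rightarrow> 'a" and d :: "nat \<Rightarrow> complex"
  obtain C where C: "finite C" "\<sigma> ` {1..m} \<subseteq> C"
    and pos: "\<And>c. 0 \<le> (\<Sum>x\<in>C. \<Sum>y\<in>C. K x y * c y * cnj (c x))"
    using ex[of "\<sigma> ` {1..m}"] by auto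
  let ?c = "\<lambda>x. \<Sum>i\<in>{i\<in>{1..m}. \<sigma> i = x}. d i"
  have "(\<Sum>i = 1..m. \<Sum>j = 1..m. K (\<sigma> i) (\<sigma> j) * d j * cnj (d i))
      = (\<Sum>x\<in>C. \<Sum>i\<in>{i\<in>{1..m}. \<sigma> i = x}. \<Sum>j = 1..m. K x (\<sigma> j) * d j * cnj (d i))"
    by (subst sum.group[OF _ C, symmetric]) (auto intro!: sum.cong)
  also have "\<dots> = (\<Sum>x\<in>C. \<Sum>i\<in>{i\<in>{1..m}. \<sigma> i = x}. \<Sum>y\<in>C. \<Sum>j\<in>{j\<in>{1..m}. \<sigma> j = y}. K x y * d j * cnj (d i))"
    by (subst sum.group[OF _ C, symmetric]) (auto intro!: sum.cong)
  also have "\<dots> = (\<Sum>x\<in>C. \<Sum>y\<in>C. \<Sum>i\<in>{i\<in>{1..m}. \<sigma> i = x}. \<Sum>j\<in>{j\<in>{1..m}. \<sigma> j = y}. K x y * d j * cnj (d i))"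
    by (intro sum.cong refl sum.swap)
  also have "\<dots> = (\<Sum>x\<in>C. \<Sum>y\<in>C. K x y * ?c y * cnj (?c x))"
    by (simp add: sum_distrib_left sum_distrib_right)
  finally show "0 \<le> (\<Sum>i = 1..m. \<Sum>j = 1..m. K (\<sigma> i) (\<sigma> j) * d j * cnj (d i))"
    by (simp only: pos)
qed

lemma positive_definite_kernelD:
  assumes "positive_definite_kernel K" "finite A"
  shows "0 \<le> (\<Sum>x\<in>A. \<Sum>y\<in>A. K x y * c y * cnj (c x))"
proof (cases "A = {}")
  case False
  obtain \<sigma> where \<sigma>: "bij_betw \<sigma> {1..card A} A"
    using ex_bij_betw_nat_finite_1[OF assms(2)] by auto
  have "card A \<ge> 1" using False assms(2) by (simp add: Suc_leI card_gt_0_iff)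
  then have "0 \<le> (\<Sum>i = 1..card A. \<Sum>j = 1..card A. K (\<sigma> i) (\<sigma> j) * c (\<sigma> j) * cnj (c (\<sigma> i)))"
    using assms(1)[unfolded positive_definite_kernel_def, rule_format, of _ \<sigma> "\<lambda>i. c (\<sigma> i)"] by simp
  also have "\<dots> = (\<Sum>i = 1..card A. \<Sum>y\<in>A. K (\<sigma> i) y * c y * cnj (c (\<sigma> i)))"
    by (intro sum.cong refl sum.reindex_bij_betw[OF \<sigma>])
  also have "\<dots> = (\<Sum>x\<in>A. \<Sum>y\<in>A. K x y * c y * cnj (c x))"
    by (rule sum.reindex_bij_betw[OF \<sigma>])
  finally show ?thesis .
qed simp

text \<open>In the order on \<open>complex\<close>, being at least 0 includes being real.
  Coefficients \<open>1, 1\<close> make the imaginary parts of \<open>K x y\<close> and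
  \<open>K y x\<close> cancel; coefficients \<open>1, \<i>\<close> make their real parts
  equal.\<close>

lemma positive_definite_kernel_hermitian:
  assumes "positive_definite_kernel K"
  shows "K y x = cnj (K x y)"
proof (cases "x = y")
  case True
  have "0 \<le> K x x"
    using positive_definite_kernelD[OF assms, of "{x}" "\<lambda>_. 1"] by simp
  then show ?thesis using True by (simp add: less_eq_complex_def complex_eq_iff)
next
  case False
  have "0 \<le> K x x" "0 \<le> K y y"
    using positive_definite_kernelD[OF assms, of "{x}" "\<lambda>_. 1"]
      positive_definite_kernelD[OF assms, of "{y}" "\<lambda>_. 1"] by auto
  moreover have "0 \<le> K x x + K x y + (K y x + K y y)"
    using positive_definite_kernelD[OF assms, of "{x, y}" "\<lambda>_. 1"] False by simp
  moreover have "0 \<le> K x x + K x y * \<i> + (K y x * cnj \<i> + K y y)"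
    using positive_definite_kernelD[OF assms, of "{x, y}" "\<lambda>a. if a = x then 1 else \<i>"] False
    by (simp add: mult.assoc)
  ultimately show ?thesis by (simp add: less_eq_complex_def complex_eq_iff)
qed

text \<open>The matrix \<open>X + X^* - 1\<close> with \<open>X\<close> the Toeplitz matrix of
  \<open>s\<close>: for \<open>s [] = 1\<close> the diagonal is counted twice, and the identity is
  subtracted once.\<close>

definition toeplitz_kernel :: "('n list \<Rightarrow> complex) \<Rightarrow> 'n list \<Rightarrow> 'n list \<Rightarrow> complex" where
  "toeplitz_kernel s \<sigma> \<tau> = toeplitz s \<sigma> \<tau> + cnj (toeplitz s \<tau> \<sigma>) - (if \<sigma> = \<tau> then 1 else 0)"

lemma toeplitz_kernel_Nil: "s [] = 1 \<Longrightarrow> toeplitz_kernel s [] = s"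
  by (auto simp: toeplitz_kernel_def toeplitz_def fun_eq_iff)

lemma multi_Toeplitz_toeplitz_kernel: "multi_Toeplitz (toeplitz_kernel s)"
  by (auto simp: multi_Toeplitz_def toeplitz_kernel_def toeplitz_append toeplitz_def prefix_def)

text \<open>Invariance strips the common prefix of comparable words, Hermitian symmetry reduces the
  lower half to the upper one, and incomparable words give 0 on both sides.\<close>

lemma multi_Toeplitz_eq_toeplitz_kernel:
  assumes pd: "positive_definite_kernel K" and mT: "multi_Toeplitz K" and one: "K [] [] = 1"
  shows "K = toeplitz_kernel (K [])"
proof (intro ext)
  fix \<sigma> \<tau> :: "'a list"
  have inv: "K (\<rho> @ \<alpha>) (\<rho> @ \<beta>) = K \<alpha> \<beta>" for \<rho> \<alpha> \<beta>
    using mT by (simp add: multi_Toeplitz_def)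
  have inv1: "K \<rho> (\<rho> @ \<beta>) = K [] \<beta>" for \<rho> \<beta> using inv[of \<rho> "[]"] by simp
  have inv2: "K (\<rho> @ \<alpha>) \<rho> = cnj (K [] \<alpha>)" for \<rho> \<alpha>
    using inv[of \<rho> _ "[]"] positive_definite_kernel_hermitian[OF pd, of \<alpha> "[]"] by simp
  \<comment> \<open>The diagonal belongs to the first case alone, where \<open>K [] [] = 1\<close>
    accounts for the subtracted identity.\<close>
  consider \<alpha> where "\<tau> = \<sigma> @ \<alpha>" | \<alpha> where "\<sigma> = \<tau> @ \<alpha>" "\<alpha> \<noteq> []"
    | "\<not> prefix \<sigma> \<tau>" "\<not> prefix \<tau> \<sigma>"
    by (cases "prefix \<sigma> \<tau>"; cases "prefix \<tau> \<sigma>") (auto simp: prefix_def)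
  then show "K \<sigma> \<tau> = toeplitz_kernel (K []) \<sigma> \<tau>"
  proof cases
    case 1
    then show ?thesis using inv1[of \<sigma> \<alpha>] one
      by (auto simp: toeplitz_kernel_def toeplitz_def)
  next
    case 2
    then show ?thesis using inv2[of \<tau> \<alpha>]
      by (auto simp: toeplitz_kernel_def toeplitz_def)
  next
    case 3
    then have "K \<sigma> \<tau> = 0" using mT by (auto simp: multi_Toeplitz_def prefix_def)
    with 3 show ?thesis by (auto simp: toeplitz_kernel_def toeplitz_def)
  qed
qed

section \<open>The correspondence between a row and its Schur symbol\<close>

definition schur_symbol :: "('n list \<Rightarrow> complex) \<Rightarrow> 'n list \<Rightarrow> complex" where
  "schur_symbol s \<tau> = unit_mass \<tau> - conv_inverse s \<tau>"

lemma schur_symbol_convolution: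
  "s [] = 1 \<Longrightarrow> convolution (schur_symbol s) s = (\<lambda>\<tau>. s \<tau> - unit_mass \<tau>)"
  unfolding schur_symbol_def
  by (simp add: fun_eq_iff convolution_diff_left convolution_unit_left conv_inverse_left)

lemma schur_symbol_Nil: "schur_symbol s [] = 0"
  by (simp add: schur_symbol_def unit_mass_def conv_inverse_Nil)

lemma schur_symbol_inject:
  assumes "s [] = 1" "s' [] = 1" "schur_symbol s = schur_symbol s'"
  shows "s = s'"
proof -
  have "conv_inverse s = conv_inverse s'"
    using assms(3) by (simp add: schur_symbol_def fun_eq_iff)
  then show ?thesis using assms(1,2) by (metis conv_inverse_inverse)
qed

text \<open>The preimage is the inverse of the unit mass minus \<open>z\<close>; the hypothesis on
  \<open>z\<close> gives this difference the value 1 at the empty word.\<close>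

lemma schur_symbol_surj:
  assumes "z [] = 0"
  obtains s where "s [] = 1" "schur_symbol s = z"
proof -
  let ?h = "\<lambda>\<tau>. unit_mass \<tau> - z \<tau>"
  have "?h [] = 1" using assms by (simp add: unit_mass_def)
  then have "conv_inverse (conv_inverse ?h) = ?h" by (rule conv_inverse_inverse)
  then have "schur_symbol (conv_inverse ?h) = z" by (simp add: schur_symbol_def fun_eq_iff)
  then show thesis using that conv_inverse_Nil by blast
qed

text \<open>With \<open>X\<close>, \<open>Z\<close> the Toeplitz matrices of \<open>s\<close> and of its symbol, \<open>Z X = X - 1\<close>; hence
  \<open>X\<^sup>* (1 - Z\<^sup>* Z) X = X\<^sup>* X - (X - 1)\<^sup>* (X - 1) = X + X\<^sup>* - 1\<close>, which is the kernel.\<close>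

lemma toeplitz_kernel_quadratic_form:
  fixes c :: "'n::finite list \<Rightarrow> complex"
  assumes s: "s [] = 1" and d: "\<And>\<sigma>. d \<sigma> = (\<Sum>\<tau>\<in>words n. toeplitz s \<sigma> \<tau> * c \<tau>)"
  shows "(\<Sum>\<sigma>\<in>words n. \<Sum>\<tau>\<in>words n. toeplitz_kernel s \<sigma> \<tau> * c \<tau> * cnj (c \<sigma>))
    = of_real ((\<Sum>\<sigma>\<in>words n. (cmod (d \<sigma>))\<^sup>2)
        - (\<Sum>\<sigma>\<in>words n. (cmod (\<Sum>\<tau>\<in>words n. toeplitz (schur_symbol s) \<sigma> \<tau> * d \<tau>))\<^sup>2))"
proof -
  let ?W = "words n :: 'n list set"
  note W = finite_words[of n, where 'n = 'n]
  \<comment> \<open>Here \<open>d = X c\<close>, so \<open>Z d = Z X c = (X - 1) c = d - c\<close>.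
    Closure of \<open>words n\<close> under prefixes makes the compressed matrices multiply like the
    full ones.\<close>
  have Z: "(\<Sum>\<tau>\<in>?W. toeplitz (schur_symbol s) \<sigma> \<tau> * d \<tau>) = d \<sigma> - c \<sigma>" if "\<sigma> \<in> ?W" for \<sigma>
  proof -
    have "(\<Sum>\<tau>\<in>?W. toeplitz (schur_symbol s) \<sigma> \<tau> * d \<tau>)
        = (\<Sum>\<tau>\<in>?W. toeplitz (\<lambda>\<tau>. s \<tau> - unit_mass \<tau>) \<sigma> \<tau> * c \<tau>)"
      unfolding d by (subst toeplitz_apply_convolution[OF W])
        (auto intro: prefix_words simp: schur_symbol_convolution s)
    also have "\<dots> = d \<sigma> - (\<Sum>\<tau>\<in>?W. (if \<sigma> = \<tau> then 1 else 0) * c \<tau>)"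
      by (simp add: toeplitz_diff toeplitz_unit_mass left_diff_distrib sum_subtractf d)
    also have "(\<Sum>\<tau>\<in>?W. (if \<sigma> = \<tau> then 1 else 0) * c \<tau>) = (\<Sum>\<tau>\<in>?W. if \<sigma> = \<tau> then c \<tau> else 0)"
      by (intro sum.cong) auto
    finally show ?thesis using that W by simp
  qed
  have diag: "(\<Sum>\<tau>\<in>?W. (if \<sigma> = \<tau> then 1 else 0) * c \<tau> * cnj (c \<sigma>)) = c \<sigma> * cnj (c \<sigma>)"
    if "\<sigma> \<in> ?W" for \<sigma>
  proof -
    have "(\<Sum>\<tau>\<in>?W. (if \<sigma> = \<tau> then 1 else 0) * c \<tau> * cnj (c \<sigma>))
        = (\<Sum>\<tau>\<in>?W. if \<sigma> = \<tau> then c \<tau> * cnj (c \<sigma>) else 0)"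
      by (intro sum.cong) auto
    then show ?thesis using that W by simp
  qed
  have upper: "(\<Sum>\<sigma>\<in>?W. \<Sum>\<tau>\<in>?W. toeplitz s \<sigma> \<tau> * c \<tau> * cnj (c \<sigma>)) = (\<Sum>\<sigma>\<in>?W. d \<sigma> * cnj (c \<sigma>))"
    by (simp add: d sum_distrib_right)
  have "(\<Sum>\<sigma>\<in>?W. \<Sum>\<tau>\<in>?W. cnj (toeplitz s \<tau> \<sigma>) * c \<tau> * cnj (c \<sigma>))
      = (\<Sum>\<tau>\<in>?W. \<Sum>\<sigma>\<in>?W. cnj (toeplitz s \<tau> \<sigma>) * c \<tau> * cnj (c \<sigma>))"
    by (rule sum.swap)
  also have "\<dots> = (\<Sum>\<tau>\<in>?W. cnj (d \<tau>) * c \<tau>)"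
    by (simp add: d sum_distrib_left sum_distrib_right mult_ac)
  finally have lower: "(\<Sum>\<sigma>\<in>?W. \<Sum>\<tau>\<in>?W. cnj (toeplitz s \<tau> \<sigma>) * c \<tau> * cnj (c \<sigma>))
      = (\<Sum>\<sigma>\<in>?W. cnj (d \<sigma>) * c \<sigma>)" .
  have diag: "(\<Sum>\<sigma>\<in>?W. \<Sum>\<tau>\<in>?W. (if \<sigma> = \<tau> then 1 else 0) * c \<tau> * cnj (c \<sigma>))
      = (\<Sum>\<sigma>\<in>?W. c \<sigma> * cnj (c \<sigma>))"
    by (intro sum.cong refl diag)
  have "(\<Sum>\<sigma>\<in>?W. \<Sum>\<tau>\<in>?W. toeplitz_kernel s \<sigma> \<tau> * c \<tau> * cnj (c \<sigma>))
      = (\<Sum>\<sigma>\<in>?W. d \<sigma> * cnj (c \<sigma>) + cnj (d \<sigma>) * c \<sigma> - c \<sigma> * cnj (c \<sigma>))"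
    by (simp only: toeplitz_kernel_def left_diff_distrib distrib_right sum_subtractf sum.distrib
        upper lower diag)
  also have "\<dots> = (\<Sum>\<sigma>\<in>?W. of_real ((cmod (d \<sigma>))\<^sup>2 - (cmod (d \<sigma> - c \<sigma>))\<^sup>2))"
    by (intro sum.cong refl)
      (simp only: of_real_diff complex_norm_square complex_cnj_diff, simp add: algebra_simps)
  also have "\<dots> = of_real ((\<Sum>\<sigma>\<in>?W. (cmod (d \<sigma>))\<^sup>2)
      - (\<Sum>\<sigma>\<in>?W. (cmod (\<Sum>\<tau>\<in>?W. toeplitz (schur_symbol s) \<sigma> \<tau> * d \<tau>))\<^sup>2))"
    by (simp add: Z sum_subtractf)
  finally show ?thesis .
qed

text \<open>On each \<open>words n\<close> the form of the kernel at \<open>c\<close> is the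
  contraction defect of \<open>Z\<close> at \<open>d = X c\<close>. One direction evaluates it at
  every \<open>c\<close>; the other needs every \<open>d\<close> to arise, which holds because
  \<open>X\<close> is invertible there.\<close>

lemma positive_definite_iff_contractive:
  fixes s :: "'n::finite list \<Rightarrow> complex"
  assumes s: "s [] = 1"
  shows "positive_definite_kernel (toeplitz_kernel s) \<longleftrightarrow> contractive_matrix (toeplitz (schur_symbol s))"
proof
  assume pd: "positive_definite_kernel (toeplitz_kernel s)"
  show "contractive_matrix (toeplitz (schur_symbol s))"
  proof (rule contractive_matrixI)
    fix A :: "'n list set" assume "finite A"
    then obtain n where n: "A \<subseteq> words n" by (rule finite_subset_words)
    let ?W = "words n :: 'n list set"
    note W = finite_words[of n, where 'n = 'n]
    have "(\<Sum>\<sigma>\<in>?W. (cmod (\<Sum>\<tau>\<in>?W. toeplitz (schur_symbol s) \<sigma> \<tau> * d \<tau>))\<^sup>2) \<le> (\<Sum>\<tau>\<in>?W. (cmod (d \<tau>))\<^sup>2)"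
      for d :: "'n list \<Rightarrow> complex"
    proof -
      \<comment> \<open>This is \<open>c = X^{-1} d\<close>, so that \<open>d' = X c\<close> agrees
        with \<open>d\<close> on \<open>words n\<close>, the only words entering the sums.\<close>
      define c where "c \<sigma> = (\<Sum>\<tau>\<in>?W. toeplitz (conv_inverse s) \<sigma> \<tau> * d \<tau>)" for \<sigma>
      define d' where "d' \<sigma> = (\<Sum>\<tau>\<in>?W. toeplitz s \<sigma> \<tau> * c \<tau>)" for \<sigma>
      have d': "d' \<sigma> = d \<sigma>" if "\<sigma> \<in> ?W" for \<sigma>
      proof -
        have "d' \<sigma> = (\<Sum>\<tau>\<in>?W. (if \<sigma> = \<tau> then 1 else 0) * d \<tau>)"
          unfolding d'_def c_def
          by (subst toeplitz_apply_convolution[OF W])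
            (auto intro: prefix_words simp: conv_inverse_right s toeplitz_unit_mass)
        also have "\<dots> = (\<Sum>\<tau>\<in>?W. if \<sigma> = \<tau> then d \<tau> else 0)" by (intro sum.cong) auto
        finally show ?thesis using that W by simp
      qed
      have "0 \<le> (of_real ((\<Sum>\<sigma>\<in>?W. (cmod (d' \<sigma>))\<^sup>2)
          - (\<Sum>\<sigma>\<in>?W. (cmod (\<Sum>\<tau>\<in>?W. toeplitz (schur_symbol s) \<sigma> \<tau> * d' \<tau>))\<^sup>2)) :: complex)"
        unfolding toeplitz_kernel_quadratic_form[OF s d'_def, symmetric]
        by (rule positive_definite_kernelD[OF pd W])
      then show ?thesis by (simp add: less_eq_complex_def d')
    qed
    then show "\<exists>C. finite C \<and> A \<subseteq> C \<and> (\<forall>d. (\<Sum>x\<in>C. (cmod (\<Sum>y\<in>C. toeplitz (schur_symbol s) x y * d y))\<^sup>2)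
        \<le> (\<Sum>y\<in>C. (cmod (d y))\<^sup>2))"
      using n W by blast
  qed
next
  assume contr: "contractive_matrix (toeplitz (schur_symbol s))"
  show "positive_definite_kernel (toeplitz_kernel s)"
  proof (rule positive_definite_kernelI)
    fix A :: "'n list set" assume "finite A"
    then obtain n where n: "A \<subseteq> words n" by (rule finite_subset_words)
    note W = finite_words[of n, where 'n = 'n]
    have "0 \<le> (\<Sum>x\<in>words n. \<Sum>y\<in>words n. toeplitz_kernel s x y * c y * cnj (c x))" for c
      unfolding toeplitz_kernel_quadratic_form[where s = s and n = n and c = c, OF s refl]
      using contr W by (simp add: less_eq_complex_def contractive_matrix_def)
    then show "\<exists>C. finite C \<and> A \<subseteq> C \<and>
        (\<forall>c. 0 \<le> (\<Sum>x\<in>C. \<Sum>y\<in>C. toeplitz_kernel s x y * c y * cnj (c x)))"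
      using n W by blast
  qed
qed

section \<open>The operator of a kernel\<close>

definition toeplitz_row :: "('n list \<Rightarrow> complex) \<Rightarrow> nat \<Rightarrow> 'n block" where
  "toeplitz_row f j \<sigma> \<tau> = (if \<sigma> = [] \<and> length \<tau> = j then f \<tau> else 0)"

text \<open>Matches the convention that rows are continued by 0 beyond \<open>n\<close>, so that
  equality of rows is equality of functions on \<open>words n\<close>.\<close>

definition truncate :: "nat \<Rightarrow> ('n list \<Rightarrow> complex) \<Rightarrow> 'n list \<Rightarrow> complex" where
  "truncate n f \<tau> = (if length \<tau> \<le> n then f \<tau> else 0)"

lemma truncate_words: "\<tau> \<in> words n \<Longrightarrow> truncate n f \<tau> = f \<tau>"
  by (simp add: truncate_def words_def)

text \<open>Each \<open>direct_sum\<close> removes one common first letter from both indices, which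
  is also how \<open>toeplitz\<close> behaves; induction on the row index reaches the empty
  word.\<close>

lemma U_toeplitz_row: "U (toeplitz_row f) i j \<sigma> \<tau> = (if length \<sigma> = i \<and> length \<tau> = j then toeplitz f \<sigma> \<tau> else 0)"
proof (induction i arbitrary: j \<sigma> \<tau>)
  case 0
  show ?case by (auto simp: toeplitz_row_def toeplitz_Nil)
next
  case (Suc i)
  show ?case
  proof (cases j)
    case 0
    then show ?thesis by (auto simp: zero_block_def toeplitz_def)
  next
    case (Suc k)
    then show ?thesis using Suc.IH
      by (cases \<sigma>; cases \<tau>) (auto simp: toeplitz_Cons_Cons)
  qed
qed

lemma U_toeplitz_row_lower: "j < i \<Longrightarrow> U (toeplitz_row f) i j = zero_block"
  by (auto simp: fun_eq_iff U_toeplitz_row zero_block_def toeplitz_def dest: prefix_length_le)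

lemma rowsE:
  assumes "x \<in> rows n"
  obtains f where "x = toeplitz_row (truncate n f)"
proof
  show "x = toeplitz_row (truncate n (\<lambda>\<tau>. x (length \<tau>) [] \<tau>))"
  proof (intro ext)
    fix j \<sigma> \<tau>
    show "x j \<sigma> \<tau> = toeplitz_row (truncate n (\<lambda>\<tau>. x (length \<tau>) [] \<tau>)) j \<sigma> \<tau>"
      using assms by (cases "j \<le> n") (auto simp: rows_def blocks_def toeplitz_row_def truncate_def zero_block_def)
  qed
qed

lemma toeplitz_row_truncate_in_rows: "toeplitz_row (truncate n f) \<in> rows n"
  by (auto simp: rows_def blocks_def toeplitz_row_def truncate_def zero_block_def fun_eq_iff)

lemma toeplitz_row_truncate_cong:
  "(\<And>\<tau>. \<tau> \<in> words n \<Longrightarrow> f \<tau> = g \<tau>) \<Longrightarrow> toeplitz_row (truncate n f) = toeplitz_row (truncate n g)"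
  by (auto simp: fun_eq_iff toeplitz_row_def truncate_def words_def)

lemma x_row_eq: "K [] [] = 1 \<Longrightarrow> x_row K n = toeplitz_row (truncate n (K []))"
  by (auto simp: fun_eq_iff x_row_def toeplitz_row_def truncate_def kernel_block_def zero_block_def)

lemma y_row_eq:
  "K [] [] = 1 \<Longrightarrow> y_row K n = toeplitz_row (truncate n (\<lambda>\<tau>. K [] \<tau> - unit_mass \<tau>))"
  by (auto simp: fun_eq_iff y_row_def toeplitz_row_def truncate_def kernel_block_def zero_block_def unit_mass_def)

lemma opmat_eq_U_toeplitz_row: "opmat_eq n (U (toeplitz_row f)) (U (toeplitz_row g)) \<longleftrightarrow> (\<forall>\<tau>\<in>words n. f \<tau> = g \<tau>)"
proof
  assume eq: "opmat_eq n (U (toeplitz_row f)) (U (toeplitz_row g))"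
  show "\<forall>\<tau>\<in>words n. f \<tau> = g \<tau>"
  proof
    fix \<tau> :: "'a list" assume "\<tau> \<in> words n"
    then have "U (toeplitz_row f) 0 (length \<tau>) [] \<tau> = U (toeplitz_row g) 0 (length \<tau>) [] \<tau>"
      using eq by (simp add: opmat_eq_def words_def del: U.simps)
    then show "f \<tau> = g \<tau>" by (simp add: U_toeplitz_row toeplitz_Nil del: U.simps)
  qed
next
  assume "\<forall>\<tau>\<in>words n. f \<tau> = g \<tau>"
  then show "opmat_eq n (U (toeplitz_row f)) (U (toeplitz_row g))"
    by (auto simp: opmat_eq_def fun_eq_iff U_toeplitz_row toeplitz_def words_def)
qed

text \<open>The block product sums over lengths and then over words of that length, that is, over
  \<open>words n\<close>. For \<open>j \<le> n\<close> this set contains every prefix of a word of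
  length \<open>j\<close>.\<close>

lemma opmat_mult_U_toeplitz_row:
  fixes f g :: "'n::finite list \<Rightarrow> complex"
  assumes "j \<le> n"
  shows "opmat_mult n (U (toeplitz_row f)) (U (toeplitz_row g)) i j = U (toeplitz_row (convolution f g)) i j"
proof (intro ext)
  fix \<sigma> \<tau> :: "'n list"
  let ?W = "words n :: 'n list set"
  note W = finite_words[of n, where 'n = 'n]
  have "opmat_mult n (U (toeplitz_row f)) (U (toeplitz_row g)) i j \<sigma> \<tau>
      = (\<Sum>k\<le>n. \<Sum>\<rho>\<in>{\<rho>\<in>?W. length \<rho> = k}. U (toeplitz_row f) i (length \<rho>) \<sigma> \<rho> * U (toeplitz_row g) (length \<rho>) j \<rho> \<tau>)"
    unfolding opmat_mult_def by (intro sum.cong refl) (auto simp: words_def)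
  also have "\<dots> = (\<Sum>\<rho>\<in>?W. U (toeplitz_row f) i (length \<rho>) \<sigma> \<rho> * U (toeplitz_row g) (length \<rho>) j \<rho> \<tau>)"
    by (rule sum.group[OF W]) (auto simp: words_def)
  also have "\<dots> = U (toeplitz_row (convolution f g)) i j \<sigma> \<tau>"
  proof (cases "length \<sigma> = i \<and> length \<tau> = j")
    case True
    then have "{\<rho>. prefix \<rho> \<tau>} \<subseteq> ?W" using assms by (auto simp: words_def dest: prefix_length_le)
    with True show ?thesis by (simp add: U_toeplitz_row toeplitz_convolution[OF W])
  next
    case False
    then show ?thesis by (auto simp: U_toeplitz_row)
  qed
  finally show "opmat_mult n (U (toeplitz_row f)) (U (toeplitz_row g)) i j \<sigma> \<tau> = U (toeplitz_row (convolution f g)) i j \<sigma> \<tau>" .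
qed

text \<open>Restricted to \<open>words n\<close>, the defining equation says
  \<open>z * s = s - unit_mass\<close>. The symbol solves it on all words, and cancelling
  \<open>s\<close> on the right gives uniqueness.\<close>

lemma z_row_eq:
  fixes K :: "'n::finite list \<Rightarrow> 'n list \<Rightarrow> complex"
  assumes one: "K [] [] = 1"
  shows "z_row K n = toeplitz_row (truncate n (schur_symbol (K [])))"
proof -
  let ?s = "K []"
  have iff: "opmat_eq n (U (y_row K n)) (opmat_mult n (U (toeplitz_row (truncate n f))) (U (x_row K n)))
      \<longleftrightarrow> (\<forall>\<tau>\<in>words n. ?s \<tau> - unit_mass \<tau> = convolution f ?s \<tau>)" for f
  proof -
    have "opmat_eq n (U (y_row K n)) (opmat_mult n (U (toeplitz_row (truncate n f))) (U (x_row K n)))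
        \<longleftrightarrow> opmat_eq n (U (toeplitz_row (truncate n (\<lambda>\<tau>. ?s \<tau> - unit_mass \<tau>))))
              (U (toeplitz_row (convolution (truncate n f) (truncate n ?s))))"
      by (simp add: opmat_eq_def x_row_eq[of K, OF one] y_row_eq[of K, OF one] opmat_mult_U_toeplitz_row)
    also have "\<dots> \<longleftrightarrow> (\<forall>\<tau>\<in>words n. ?s \<tau> - unit_mass \<tau> = convolution f ?s \<tau>)"
      unfolding opmat_eq_U_toeplitz_row
      by (intro ball_cong refl arg_cong2[where f = "(=)"] truncate_words convolution_cong_words)
        (simp_all add: truncate_words)
    finally show ?thesis .
  qed
  show ?thesis
    unfolding z_row_def
  proof (rule the_equality)
    show "toeplitz_row (truncate n (schur_symbol ?s)) \<in> rows n \<and>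
        opmat_eq n (U (y_row K n)) (opmat_mult n (U (toeplitz_row (truncate n (schur_symbol ?s)))) (U (x_row K n)))"
      unfolding iff by (simp add: toeplitz_row_truncate_in_rows schur_symbol_convolution one)
  next
    fix z assume z: "z \<in> rows n \<and> opmat_eq n (U (y_row K n)) (opmat_mult n (U z) (U (x_row K n)))"
    then obtain f where f: "z = toeplitz_row (truncate n f)" by (blast elim: rowsE)
    have eq: "convolution f ?s \<tau> = convolution (schur_symbol ?s) ?s \<tau>" if "\<tau> \<in> words n" for \<tau>
      using z that unfolding f iff by (simp add: schur_symbol_convolution one)
    have "f \<tau> = schur_symbol ?s \<tau>" if "\<tau> \<in> words n" for \<tau>
    proof -
      \<comment> \<open>A convolution at \<tau> only sees words no longer than \<tau>, so the
        equality known on \<open>words n\<close> survives convolving with the inverse.\<close>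
      have "convolution (convolution f ?s) (conv_inverse ?s) \<tau>
          = convolution (convolution (schur_symbol ?s) ?s) (conv_inverse ?s) \<tau>"
        by (rule convolution_cong_words[OF eq refl that])
      then show ?thesis
        by (simp add: convolution_assoc conv_inverse_right one convolution_unit_right)
    qed
    then show "z = toeplitz_row (truncate n (schur_symbol ?s))" unfolding f by (rule toeplitz_row_truncate_cong)
  qed
qed

section \<open>The Schur class as the contractive Toeplitz matrices\<close>

lemma entry_eq_U_toeplitz_row_iff:
  "(\<forall>i j. entry T i j = U (toeplitz_row z) i j)
    \<longleftrightarrow> (\<forall>\<sigma> \<tau>. coord (blinfun_apply T (basis_ell2 \<tau>)) \<sigma> = toeplitz z \<sigma> \<tau>)"
  by (auto simp: fun_eq_iff entry_def U_toeplitz_row)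

text \<open>The two conditions on the blocks are exactly the recursion of \<open>U\<close>, so the
  blocks are rebuilt from the top row, which is where \<open>z\<close> is read off.\<close>

lemma Schur_class_iff:
  "T \<in> Schur_class \<longleftrightarrow> complex_linear T \<and> norm T \<le> 1 \<and> (\<exists>z. \<forall>i j. entry T i j = U (toeplitz_row z) i j)"
proof
  assume T: "T \<in> Schur_class"
  define z where "z \<tau> = entry T 0 (length \<tau>) [] \<tau>" for \<tau>
  have "entry T i j = U (toeplitz_row z) i j" for i j
  proof (induction i arbitrary: j)
    case 0
    show ?case by (auto simp: fun_eq_iff z_def entry_def toeplitz_row_def)
  next
    case (Suc i)
    show ?case
    proof (cases j)
      case 0
      then show ?thesis using T by (simp add: Schur_class_def)
    next
      case (Suc k)
      show ?thesis
      \<comment> \<open>The direct sum rule is available only on and above the diagonal; below it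
        both sides are zero blocks.\<close>
      proof (cases "i \<le> k")
        case True
        then have "entry T (Suc i) (Suc k) = direct_sum (entry T i k)"
          using T by (simp add: Schur_class_def)
        then show ?thesis by (simp add: Suc Suc.IH)
      next
        case False
        then show ?thesis using T Suc by (simp add: Schur_class_def U_toeplitz_row_lower del: U.simps)
      qed
    qed
  qed
  then show "complex_linear T \<and> norm T \<le> 1 \<and> (\<exists>z. \<forall>i j. entry T i j = U (toeplitz_row z) i j)"
    using T by (auto simp: Schur_class_def complex_linear_def)
next
  assume "complex_linear T \<and> norm T \<le> 1 \<and> (\<exists>z. \<forall>i j. entry T i j = U (toeplitz_row z) i j)"
  then obtain z where T: "complex_linear T" "norm T \<le> 1" and z: "\<And>i j. entry T i j = U (toeplitz_row z) i j"
    by blast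
  have "entry T i j = direct_sum (entry T (i - 1) (j - 1))" if "1 \<le> i" "i \<le> j" for i j
    using that z by (cases i; cases j) simp_all
  with T show "T \<in> Schur_class"
    by (auto simp: Schur_class_def complex_linear_def z U_toeplitz_row_lower)
qed

lemma Schur_class_eqI:
  assumes "S \<in> Schur_class" "T \<in> Schur_class" "\<And>i j. entry S i j = entry T i j"
  shows "S = T"
proof (rule complex_linear_eqI)
  show "complex_linear S" "complex_linear T" using assms(1,2) by (auto simp: Schur_class_iff)
  fix \<sigma> \<tau>
  show "coord (blinfun_apply S (basis_ell2 \<tau>)) \<sigma> = coord (blinfun_apply T (basis_ell2 \<tau>)) \<sigma>"
    using fun_cong[OF fun_cong[OF assms(3)[of "length \<sigma>" "length \<tau>"]], of \<sigma> \<tau>]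
    by (simp add: entry_def)
qed

lemma contractive_matrix_Schur_class:
  assumes "T \<in> Schur_class" "\<And>i j. entry T i j = U (toeplitz_row z) i j"
  shows "contractive_matrix (toeplitz z)"
proof -
  have "contractive_matrix (\<lambda>x y. coord (blinfun_apply T (basis_ell2 y)) x)"
    using assms(1) by (intro contractive_matrix_operator) (auto simp: Schur_class_iff)
  then show ?thesis using assms(2) entry_eq_U_toeplitz_row_iff[of T z] by simp
qed

lemma Schur_class_of_contractive_matrix:
  assumes "contractive_matrix (toeplitz z)"
  obtains T where "T \<in> Schur_class" "\<forall>i j. entry T i j = U (toeplitz_row z) i j"
proof -
  obtain T where T: "complex_linear T" "norm T \<le> 1"
    and c: "\<And>\<sigma> \<tau>. coord (blinfun_apply T (basis_ell2 \<tau>)) \<sigma> = toeplitz z \<sigma> \<tau>"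
    using operator_of_contractive_matrix[OF assms] by metis
  have "\<forall>i j. entry T i j = U (toeplitz_row z) i j" unfolding entry_eq_U_toeplitz_row_iff using c by blast
  with T show thesis by (intro that[of T]) (auto simp: Schur_class_iff)
qed

lemma opmat_eq_z_row_iff:
  fixes K :: "'n::finite list \<Rightarrow> 'n list \<Rightarrow> complex"
  assumes one: "K [] [] = 1"
  shows "(\<forall>n\<ge>1. opmat_eq n A (U (z_row K n))) \<longleftrightarrow> (\<forall>i j. A i j = U (toeplitz_row (schur_symbol (K []))) i j)"
proof -
  have *: "opmat_eq n (U (toeplitz_row (truncate n f))) (U (toeplitz_row f))" for n and f :: "'n list \<Rightarrow> complex"
    by (simp add: opmat_eq_U_toeplitz_row truncate_words)
  have "opmat_eq n A (U (z_row K n)) \<longleftrightarrow> opmat_eq n A (U (toeplitz_row (schur_symbol (K []))))" for n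
    using *[of n "schur_symbol (K [])"] unfolding z_row_eq[of K, OF one] opmat_eq_def by simp
  moreover have "(\<forall>n\<ge>1. opmat_eq n A B) \<longleftrightarrow> (\<forall>i j. A i j = B i j)" for B
  proof
    assume eq: "\<forall>n\<ge>1. opmat_eq n A B"
    show "\<forall>i j. A i j = B i j"
    proof (intro allI)
      fix i j
      show "A i j = B i j"
        \<comment> \<open>A compression large enough to contain the block \<open>(i, j)\<close>; the
          successor ensures \<open>n \<ge> 1\<close>.\<close>
        using eq[rule_format, of "Suc (i + j)"] by (simp add: opmat_eq_def)
    qed
  qed (simp add: opmat_eq_def)
  ultimately show ?thesis by simp
qed

lemma T_of_eq:
  fixes K :: "'n::finite list \<Rightarrow> 'n list \<Rightarrow> complex"
  assumes "K [] [] = 1" "T \<in> Schur_class" "\<And>i j. entry T i j = U (toeplitz_row (schur_symbol (K []))) i j"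
  shows "T_of K = T"
  unfolding T_of_def opmat_eq_z_row_iff[of K, OF assms(1)]
  by (rule the_equality) (use assms(2,3) in \<open>auto intro: Schur_class_eqI\<close>)

text \<open>Positive definiteness supplies a contraction with the required compressions, so the
  definite description in \<open>T_of\<close> denotes it.\<close>

lemma T_of_Schur_class:
  fixes K :: "'n::finite list \<Rightarrow> 'n list \<Rightarrow> complex"
  assumes "positive_definite_kernel K" "multi_Toeplitz K" "K [] [] = 1"
  shows "T_of K \<in> Schur_class" "entry (T_of K) i j = U (toeplitz_row (schur_symbol (K []))) i j"
proof -
  have "positive_definite_kernel (toeplitz_kernel (K []))"
    using assms multi_Toeplitz_eq_toeplitz_kernel by metis
  then have "contractive_matrix (toeplitz (schur_symbol (K [])))"
    by (simp add: positive_definite_iff_contractive assms(3))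
  then obtain T where T: "T \<in> Schur_class"
      and entry: "\<forall>i j. entry T i j = U (toeplitz_row (schur_symbol (K []))) i j"
    by (rule Schur_class_of_contractive_matrix)
  then have "T_of K = T" using assms(3) by (intro T_of_eq) auto
  then show "T_of K \<in> Schur_class" "entry (T_of K) i j = U (toeplitz_row (schur_symbol (K []))) i j"
    using T entry by simp_all
qed

lemma toeplitz_row_00_eq_zero_iff: "toeplitz_row z 0 = zero_block \<longleftrightarrow> z [] = 0"
  by (auto simp: fun_eq_iff toeplitz_row_def zero_block_def)

lemma U_toeplitz_row_inject: "(\<And>i j. U (toeplitz_row f) i j = U (toeplitz_row g) i j) \<Longrightarrow> f = g"
proof
  fix \<tau> assume "\<And>i j. U (toeplitz_row f) i j = U (toeplitz_row g) i j"
  then have "toeplitz_row f (length \<tau>) [] \<tau> = toeplitz_row g (length \<tau>) [] \<tau>" by (metis U.simps(1))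
  then show "f \<tau> = g \<tau>" by (simp add: toeplitz_row_def)
qed

theorem corollary2p5:
  shows "bij_betw (T_of :: ('n::finite list \<Rightarrow> 'n list \<Rightarrow> complex) \<Rightarrow> 'n list ell2 \<Rightarrow>\<^sub>L 'n list ell2)
           {K. positive_definite_kernel K \<and> multi_Toeplitz K \<and> K [] [] = 1}
           Schur_class0"
proof -
  let ?\<K> = "{K :: 'n list \<Rightarrow> 'n list \<Rightarrow> complex.
    positive_definite_kernel K \<and> multi_Toeplitz K \<and> K [] [] = 1}"
  have "inj_on T_of ?\<K>"
  proof (rule inj_onI)
    fix K L assume "K \<in> ?\<K>" "L \<in> ?\<K>" and eq: "T_of K = T_of L"
    then have K: "positive_definite_kernel K" "multi_Toeplitz K" "K [] [] = 1"
      and L: "positive_definite_kernel L" "multi_Toeplitz L" "L [] [] = 1"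
      by auto
    have "U (toeplitz_row (schur_symbol (K []))) i j = U (toeplitz_row (schur_symbol (L []))) i j" for i j
      using T_of_Schur_class(2)[OF K, of i j] T_of_Schur_class(2)[OF L, of i j] eq by simp
    then have "schur_symbol (K []) = schur_symbol (L [])" by (rule U_toeplitz_row_inject)
    then have "K [] = L []" by (rule schur_symbol_inject[of "K []" "L []", OF K(3) L(3)])
    then show "K = L"
      using multi_Toeplitz_eq_toeplitz_kernel[OF K] multi_Toeplitz_eq_toeplitz_kernel[OF L] by metis
  qed
  moreover have "T_of K \<in> Schur_class0" if "K \<in> ?\<K>" for K
    using that T_of_Schur_class[of K] by (simp add: Schur_class0_def toeplitz_row_00_eq_zero_iff schur_symbol_Nil)
  moreover have "T \<in> T_of ` ?\<K>" if "T \<in> Schur_class0" for T :: "'n list ell2 \<Rightarrow>\<^sub>L 'n list ell2"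
  proof -
    have T: "T \<in> Schur_class" using that by (simp add: Schur_class0_def)
    then obtain z where z: "\<And>i j. entry T i j = U (toeplitz_row z) i j" by (auto simp: Schur_class_iff)
    \<comment> \<open>The vanishing of the corner block is precisely what allows \<open>z\<close> to
      be a Schur symbol.\<close>
    have "z [] = 0" using that z[of 0 0] by (simp add: Schur_class0_def toeplitz_row_00_eq_zero_iff)
    then obtain s where s: "s [] = 1" "schur_symbol s = z" by (rule schur_symbol_surj)
    let ?K = "toeplitz_kernel s"
    have "positive_definite_kernel ?K"
      unfolding positive_definite_iff_contractive[of s, OF s(1)] s(2)
      by (rule contractive_matrix_Schur_class[OF T z])
    then have "?K \<in> ?\<K>" by (simp add: multi_Toeplitz_toeplitz_kernel toeplitz_kernel_Nil s)
    moreover have "T_of ?K = T"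
      by (rule T_of_eq[OF _ T]) (simp_all add: toeplitz_kernel_Nil s z)
    ultimately show ?thesis by blast
  qed
  ultimately show ?thesis unfolding bij_betw_def by blast
qed

end
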